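(* Define $\bar n(j):=e^{j(\log j)^2}$ for $j\ge1$ (so $\bar n(1)=1$, and set $\bar n(0):=0$), and for $n\in(\bar n(j-1),\bar n(j)]$ put $d'_n:=\bar n(j)\,\log\log\bar n(j)/\log 2$. Then \[ \limsup_{n\to\infty}\frac{1}{d'_n}\sum_{k=1}^n\mathsf a'_k=1\quad\text{Lebesgue-almost everywhere.} \]
   Context: $I=(0,1]$, $\mathsf a_n(x)$ denotes the $n$-th continued fraction digit of $x\in I$. $\mathbb P$ is the set of primes. The prime digits are $\mathsf a'_n(x):=\mathsf a_n(x)$ if $\mathsf a_n(x)\in\mathbb P$ and $\mathsf a'_n(x):=0$ otherwise. (Only large $n$ matter, so $d'_n$ for small $n$ where $\log\log$ is undefined may be chosen arbitrarily positive.) *)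

theory Defs
  imports "HOL-Analysis.Analysis" "HOL-Computational_Algebra.Primes"
begin

text \<open>Gauss map on (0,1]; T 0 = 0 by the convention 1/0 = 0.\<close>
definition gauss_map :: "real \<Rightarrow> real" where
  "gauss_map x = 1 / x - of_int \<lfloor>1 / x\<rfloor>"

text \<open>n-th continued fraction digit (n \<ge> 1): a_n(x) = floor(1/T^(n-1) x).
  For rational x the digits eventually become 0 (a null set, irrelevant).\<close>
definition cf_digit :: "nat \<Rightarrow> real \<Rightarrow> nat" where
  "cf_digit n x = nat \<lfloor>1 / (gauss_map ^^ (n - 1)) x\<rfloor>"

definition prime_digit :: "nat \<Rightarrow> real \<Rightarrow> nat" where
  "prime_digit n x = (if prime (cf_digit n x) then cf_digit n x else 0)"

definition nbar :: "nat \<Rightarrow> real" where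
  "nbar j = (if j = 0 then 0 else exp (real j * (ln (real j))\<^sup>2))"

text \<open>For n \<ge> 1, the unique j \<ge> 1 with nbar(j-1) < n \<le> nbar(j).\<close>
definition block_index :: "nat \<Rightarrow> nat" where
  "block_index n = (LEAST j. real n \<le> nbar j)"

definition dprime :: "nat \<Rightarrow> real" where
  "dprime n = nbar (block_index n) * ln (ln (nbar (block_index n))) / ln 2"

end

theory Submission
  imports Defs "HOL-Probability.Probability_Measure" "HOL-Real_Asymp.Real_Asymp"
begin

text \<open>
  The Gauss measure is invariant under the Gauss map, and it has the same null sets in the unit
  interval as Lebesgue measure. A digit takes the prime value \<open>p\<close> with probability about
  \<open>1 / (p\<^sup>2 ln 2)\<close>, so by Mertens' second theorem the digits truncated at \<open>N\<close> have mean about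
  \<open>ln (ln N) / ln 2\<close>. The transfer operator of the Gauss map contracts Lipschitz constants by the
  factor \<open>7 / 8\<close>, which makes the correlations of the digits decay exponentially; together with
  Chebyshev's bound \<open>O(N / ln N)\<close> for the number of primes this shows that the truncated sum over the
  first \<open>N\<close> digits deviates from its mean by a fixed proportion with probability \<open>O(1 / ln N)\<close>.
  The probability that one of the first \<open>N\<close> digits is a prime larger than \<open>N\<close> is \<open>O(1 / ln N)\<close>, too.
  For \<open>N = \<lfloor>nbar j\<rfloor>\<close> these bounds are of order \<open>1 / (j (ln j)\<^sup>2)\<close> and hence summable, so by
  Borel--Cantelli the normalised sums converge to \<open>1\<close> along the ends of the blocks. Within a block
  the normalisation is constant and the sum is largest at the end.
\<close>

section \<open>Elementary estimates for sums over primes\<close>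

text \<open>Prime digits have infinite mean, since p * 1/p^2 summed over primes diverges, and one
  huge digit can dominate a sum; this forces a truncation. The level N for N digits balances two
  errors: N times the tail of the sum of 1/p^2 over primes p > N, and a variance of at most order N
  * pi(N) against N^2. Both are O(1 / ln N) because primes are sparse; over all integers the first
  would be only O(1). As 1 / ln N is not summable along geometric sequences, the blocks have to grow
  faster, and the exponent j (ln j)^2 puts 1 / ln N on the convergent side of Bertrand's series.

  The correlations carry weights p * q that grow with the truncation level, so an additive mixing
  error would be useless; the error has to be relative to the product of the digit probabilities. It
  is, because one transfer step turns the indicator of a branch into a weight whose Lipschitz
  constant is comparable to the probability of that branch. Upper estimates of correlations are
  enough: the mean is known exactly, so an upper bound on the second moment bounds the
  variance.\<close>

definition primes_upto :: "nat \<Rightarrow> nat set" where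
  "primes_upto n = {p. prime p \<and> p \<le> n}"

lemma finite_primes_upto [simp, intro]: "finite (primes_upto n)"
  unfolding primes_upto_def by simp

lemma primes_upto_Suc:
  "primes_upto (Suc n) = (if prime (Suc n) then insert (Suc n) (primes_upto n) else primes_upto n)"
  unfolding primes_upto_def by (auto simp: le_Suc_eq)

lemma Suc_notin_primes_upto [simp]: "Suc n \<notin> primes_upto n"
  unfolding primes_upto_def by simp

lemma primes_upto_1 [simp]: "primes_upto (Suc 0) = {}"
  unfolding primes_upto_def by (auto dest: prime_ge_2_nat)

lemma primes_uptoD: "p \<in> primes_upto n \<Longrightarrow> prime p \<and> 2 \<le> p \<and> p \<le> n"
  unfolding primes_upto_def by (auto dest: prime_ge_2_nat)

section \<open>Chebyshev's upper bounds for sums over primes\<close>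

definition theta :: "nat \<Rightarrow> real" where
  "theta n = (\<Sum>p\<in>primes_upto n. ln (real p))"

lemma theta_Suc: "theta (Suc n) = theta n + (if prime (Suc n) then ln (real (Suc n)) else 0)"
  by (simp add: theta_def primes_upto_Suc)

lemma theta_nonneg: "0 \<le> theta n"
  unfolding theta_def by (intro sum_nonneg) (auto dest: primes_uptoD)

lemma prod_primes_dvd:
  fixes n :: nat
  assumes "finite A" "\<And>p. p \<in> A \<Longrightarrow> prime p \<and> p dvd n"
  shows "\<Prod>A dvd n"
  using assms
proof (induction A rule: finite_induct)
  case (insert p A)
  have "coprime p (\<Prod>A)"
    using insert by (intro prod_coprime_right) (metis insertCI primes_coprime)
  then show ?case
    using insert by (simp add: divides_mult)
qed auto

text \<open>Every prime in (m, 2m] divides \<open>2 * m choose m\<close>, hence so does the product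
  of these primes, while the binomial coefficient is at most 4^m. The constant 2 uses
  \<open>ln 2 \<le> 1\<close>.\<close>

lemma theta_double: "theta (2 * m) \<le> theta m + 2 * real m"
proof -
  define A where "A = primes_upto (2 * m) - primes_upto m"
  have fin: "finite A" by (simp add: A_def)
  have "prime p \<and> p dvd (2 * m choose m)" if "p \<in> A" for p
  proof -
    have p: "prime p" "m < p" "p \<le> 2 * m"
      using that by (auto simp: A_def primes_upto_def)
    have "p dvd fact (2 * m)"
      using p by (simp add: prime_dvd_fact_iff)
    also have "fact (2 * m) = fact m * fact m * (2 * m choose m)"
      using binomial_fact_lemma[of m "2 * m"] by (simp add: mult_2)
    finally have "p dvd fact m \<or> p dvd (2 * m choose m)"
      using p(1) by (auto simp: prime_dvd_mult_iff)
    with p show ?thesis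
      by (simp add: prime_dvd_fact_iff)
  qed
  then have "\<Prod>A dvd (2 * m choose m)"
    using fin by (intro prod_primes_dvd) auto
  then have "\<Prod>A \<le> (2 * m choose m)"
    by (intro dvd_imp_le) auto
  also have "\<dots> \<le> 2 ^ (2 * m)" by (rule binomial_le_pow2)
  finally have le: "real (\<Prod>A) \<le> 2 ^ (2 * m)"
    by (metis of_nat_le_iff of_nat_numeral of_nat_power)
  have pos: "\<forall>p\<in>A. 0 < p" by (auto simp: A_def dest: primes_uptoD)
  have "theta (2 * m) - theta m = (\<Sum>p\<in>A. ln (real p))"
    unfolding theta_def A_def by (subst sum_diff) (auto simp: primes_upto_def)
  also have "\<dots> = ln (real (\<Prod>A))"
    using fin pos by (subst of_nat_prod, subst ln_prod) auto
  also have "\<dots> \<le> ln (2 ^ (2 * m))"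
    using le pos fin by (subst ln_le_cancel_iff) (auto intro!: prod_pos simp del: of_nat_prod)
  also have "\<dots> = 2 * real m * ln 2" by (simp add: ln_realpow)
  also have "\<dots> \<le> 2 * real m * 1"
    using ln_le_minus_one[of "2::real"] by (intro mult_left_mono) auto
  finally show ?thesis by simp
qed

text \<open>Strong induction by halving. Even arguments alone would allow the constant 2; the
  constant 4 pays for the crude \<open>ln n \<le> n - 1\<close> in the odd case.\<close>

lemma theta_le: "theta n \<le> 4 * real n"
proof (induction n rule: less_induct)
  case (less n)
  consider "n = 0" | "n = 1" | m where "n = 2 * m" "0 < m" | m where "n = Suc (2 * m)" "0 < m"
    by (metis One_nat_def bot_nat_0.not_eq_extremum evenE mult_0_right oddE Suc_eq_plus1)
  then show ?case
  proof cases
    case 1 then show ?thesis by (simp add: theta_def primes_upto_def)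
  next
    case 2 then show ?thesis by (simp add: theta_def)
  next
    case (3 m)
    then show ?thesis using less[of m] theta_double[of m] by simp
  next
    case (4 m)
    have "theta n \<le> theta (2 * m) + ln (real n)"
      using 4 by (auto simp: theta_Suc)
    also have "\<dots> \<le> 6 * real m + (real n - 1)"
      using less[of m] theta_double[of m] ln_le_minus_one[of "real n"] 4 by simp
    finally show ?thesis using 4 by simp
  qed
qed

lemma ln_le_2_sqrt:
  fixes x :: real
  assumes "0 < x" shows "ln x \<le> 2 * sqrt x"
proof -
  have "ln x = 2 * ln (sqrt x)" using assms by (simp add: ln_sqrt)
  also have "\<dots> \<le> 2 * (sqrt x - 1)" using assms by (intro mult_left_mono ln_le_minus_one) auto
  finally show ?thesis by simp
qed

text \<open>Split at sqrt n. A larger prime contributes at least (ln n) / 2 to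
  \<open>theta n\<close>, which gives 8 n / ln n; there are at most sqrt n smaller ones, and sqrt n
  \<le> 2 n / ln n because ln n \<le> 2 sqrt n.\<close>

lemma card_primes_upto_le:
  assumes "2 \<le> n" shows "real (card (primes_upto n)) \<le> 10 * real n / ln (real n)"
proof -
  have n: "ln (real n) > 0" using assms by simp
  define A where "A = {p\<in>primes_upto n. sqrt (real n) < real p}"
  have fin: "finite A" by (simp add: A_def)
  have sub: "primes_upto n - A \<subseteq> {1..nat \<lfloor>sqrt (real n)\<rfloor>}"
  proof
    fix p assume "p \<in> primes_upto n - A"
    then have "2 \<le> p" "real p \<le> sqrt (real n)" by (auto simp: A_def dest: primes_uptoD)
    then show "p \<in> {1..nat \<lfloor>sqrt (real n)\<rfloor>}" by (simp add: le_nat_floor)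
  qed
  have "card (primes_upto n - A) \<le> nat \<lfloor>sqrt (real n)\<rfloor>"
    using card_mono[OF _ sub] by simp
  then have "real (card (primes_upto n - A)) \<le> real (nat \<lfloor>sqrt (real n)\<rfloor>)"
    by (rule of_nat_mono)
  also have "\<dots> \<le> sqrt (real n)" by (intro of_nat_floor) simp
  also have "\<dots> \<le> 2 * real n / ln (real n)"
  proof -
    have "sqrt (real n) * ln (real n) \<le> sqrt (real n) * (2 * sqrt (real n))"
      using assms by (intro mult_left_mono ln_le_2_sqrt) auto
    also have "\<dots> = 2 * real n" by simp
    finally show ?thesis using n by (simp add: field_simps)
  qed
  finally have 1: "real (card (primes_upto n - A)) \<le> 2 * real n / ln (real n)" .
  have "real (card A) * (ln (real n) / 2) = (\<Sum>p\<in>A. ln (sqrt (real n)))"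
    using assms by (simp add: ln_sqrt)
  also have "\<dots> \<le> (\<Sum>p\<in>A. ln (real p))"
  proof (intro sum_mono)
    fix p assume "p \<in> A"
    then have "sqrt (real n) < real p" "0 < p" by (auto simp: A_def dest: primes_uptoD)
    then show "ln (sqrt (real n)) \<le> ln (real p)" using assms by (subst ln_le_cancel_iff) auto
  qed
  also have "\<dots> \<le> theta n" unfolding theta_def
    by (intro sum_mono2) (auto simp: A_def dest: primes_uptoD)
  also have "\<dots> \<le> 4 * real n" by (rule theta_le)
  finally have 2: "real (card A) \<le> 8 * real n / ln (real n)"
    using n by (simp add: field_simps)
  have "card (primes_upto n) = card A + card (primes_upto n - A)"
    using fin card_mono[of "primes_upto n" A] by (subst card_Diff_subset) (auto simp: A_def)
  with 1 2 show ?thesis by (simp add: add_divide_distrib)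
qed

text \<open>Abel summation against \<open>theta\<close>, in a form fit for induction: the first term
  on the right is the boundary term, and the bracket collects the telescoping bounds for 4 x times
  the decrease of 1 / x^2.\<close>

lemma sum_ln_over_prime_squares_le:
  assumes "n \<le> m"
  shows "(\<Sum>p\<in>primes_upto m - primes_upto n. ln (real p) / (real p)\<^sup>2)
      \<le> theta m / (real m + 1)\<^sup>2 + 8 * (1 / (real n + 1) - 1 / (real m + 1))"
  using assms
proof (induction m rule: dec_induct)
  case base
  then show ?case using theta_nonneg[of n] by simp
next
  case (step m)
  have "(\<Sum>p\<in>primes_upto (Suc m) - primes_upto n. ln (real p) / (real p)\<^sup>2)
     = (\<Sum>p\<in>primes_upto m - primes_upto n. ln (real p) / (real p)\<^sup>2)
        + (theta (Suc m) - theta m) / (real m + 1)\<^sup>2"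
  proof (cases "prime (Suc m)")
    case True
    have "Suc m \<notin> primes_upto n" using step by (simp add: primes_upto_def)
    then have "primes_upto (Suc m) - primes_upto n = insert (Suc m) (primes_upto m - primes_upto n)"
      using True by (auto simp: primes_upto_Suc)
    then show ?thesis using True by (simp add: theta_Suc add.commute)
  qed (simp add: primes_upto_Suc theta_Suc)
  also have "\<dots> \<le> theta (Suc m) / (real m + 1)\<^sup>2 + 8 * (1 / (real n + 1) - 1 / (real m + 1))"
    using step.IH by (simp add: diff_divide_distrib)
  also have "theta (Suc m) / (real m + 1)\<^sup>2 \<le> theta (Suc m) / (real m + 2)\<^sup>2 + 8 * (1 / (real m + 1) - 1 / (real m + 2))"
  proof -
    define x where "x = real m + 1"
    have x: "x > 0" by (simp add: x_def)
    have "theta (Suc m) * (1 / x\<^sup>2 - 1 / (x + 1)\<^sup>2) \<le> (4 * x) * (1 / x\<^sup>2 - 1 / (x + 1)\<^sup>2)"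
      using theta_le[of "Suc m"] x
      by (intro mult_right_mono) (auto simp: x_def intro!: divide_left_mono power_mono)
    also have "\<dots> = 4 * (2 * x + 1) / (x * (x + 1)\<^sup>2)"
      using x by (simp add: divide_simps) (simp add: algebra_simps power2_eq_square)
    also have "\<dots> \<le> 8 * (x + 1) / (x * (x + 1)\<^sup>2)"
      using x by (intro divide_right_mono) auto
    also have "\<dots> = 8 * (1 / x - 1 / (x + 1))"
      using x by (simp add: divide_simps) (simp add: algebra_simps power2_eq_square)
    finally show ?thesis by (simp add: x_def algebra_simps)
  qed
  finally show ?case by (simp add: algebra_simps)
qed

text \<open>On the tail ln p exceeds ln n, so passing from the weights ln p / p^2 to 1 / p^2 gains
  the factor 1 / ln n over the tail of all squares. This gain makes the large prime digits summably
  rare along the blocks.\<close>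

lemma sum_prime_squares_tail_le:
  assumes "2 \<le> n"
  shows "(\<Sum>p\<in>primes_upto m - primes_upto n. 1 / (real p)\<^sup>2) \<le> 12 / (real n * ln (real n))"
proof (cases "n \<le> m")
  case True
  have ln: "ln (real n) > 0" using assms by simp
  have "ln (real n) * (\<Sum>p\<in>primes_upto m - primes_upto n. 1 / (real p)\<^sup>2)
      \<le> (\<Sum>p\<in>primes_upto m - primes_upto n. ln (real p) / (real p)\<^sup>2)"
    unfolding sum_distrib_left
  proof (intro sum_mono)
    fix p assume "p \<in> primes_upto m - primes_upto n"
    then have "n < p" by (auto simp: primes_upto_def)
    then have "ln (real n) \<le> ln (real p)" using assms by simp
    then show "ln (real n) * (1 / (real p)\<^sup>2) \<le> ln (real p) / (real p)\<^sup>2"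
      by (simp add: divide_right_mono)
  qed
  also have "\<dots> \<le> theta m / (real m + 1)\<^sup>2 + 8 * (1 / (real n + 1) - 1 / (real m + 1))"
    using True by (rule sum_ln_over_prime_squares_le)
  also have "theta m / (real m + 1)\<^sup>2 \<le> 4 * (real m + 1) / (real m + 1)\<^sup>2"
    using theta_le[of m] by (intro divide_right_mono) auto
  also have "\<dots> = 4 / (real m + 1)"
    by (simp only: power2_eq_square) (simp add: divide_simps)
  also have "4 / (real m + 1) + 8 * (1 / (real n + 1) - 1 / (real m + 1)) \<le> 8 / (real n + 1)"
    by (simp add: algebra_simps)
  also have "\<dots> \<le> 12 / real n" using assms by (intro frac_le) auto
  finally show ?thesis using ln assms by (simp add: field_simps)
next
  case False
  then have "primes_upto m - primes_upto n = {}" by (auto simp: primes_upto_def)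
  then show ?thesis using assms by (simp only: sum.empty) simp
qed

section \<open>Legendre's formula and Mertens' theorems\<close>

lemma card_multiples:
  assumes "0 < d" shows "card {m\<in>{1..n}. d dvd m} = n div (d::nat)"
proof -
  have "{m\<in>{1..n}. d dvd m} = (*) d ` {1..n div d}"
  proof (intro equalityI subsetI)
    fix m assume m: "m \<in> {m\<in>{1..n}. d dvd m}"
    then obtain k where "m = d * k" by auto
    with m assms show "m \<in> (*) d ` {1..n div d}"
      by (auto simp: less_eq_div_iff_mult_less_eq mult.commute intro!: imageI)
  next
    fix m assume "m \<in> (*) d ` {1..n div d}"
    with assms show "m \<in> {m\<in>{1..n}. d dvd m}"
      by (auto simp: less_eq_div_iff_mult_less_eq mult.commute)
  qed
  moreover have "inj_on ((*) d) {1..n div d}" using assms by (auto simp: inj_on_def)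
  ultimately show ?thesis by (simp add: card_image)
qed

text \<open>The exponents range up to \<open>n\<close>, independently of \<open>m\<close>, so that
  the sums over \<open>m\<close> and \<open>k\<close> can be exchanged. Nothing is lost: the
  multiplicity is smaller than p to that power, which is at most m.\<close>

lemma multiplicity_eq_card:
  assumes "prime (p::nat)" "0 < m" "m \<le> n"
  shows "multiplicity p m = card {k\<in>{1..n}. p ^ k dvd m}"
proof -
  have iff: "p ^ k dvd m \<longleftrightarrow> k \<le> multiplicity p m" for k
    using assms by (intro power_dvd_iff_le_multiplicity) auto
  have "multiplicity p m < p ^ multiplicity p m"
    using assms(1) by (intro power_gt_expt) (auto dest: prime_gt_1_nat)
  also have "\<dots> \<le> m"
    using assms by (intro dvd_imp_le multiplicity_dvd) auto
  finally have "{k\<in>{1..n}. p ^ k dvd m} = {1..multiplicity p m}"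
    using assms by (auto simp: iff)
  then show ?thesis by simp
qed

text \<open>Legendre's formula for the exponent of p in n!, by double counting the pairs (m, k) with
  p^k dividing m.\<close>

lemma sum_multiplicity:
  assumes "prime (p::nat)"
  shows "(\<Sum>m=1..n. multiplicity p m) = (\<Sum>k=1..n. n div p ^ k)"
proof -
  have "(\<Sum>m=1..n. multiplicity p m) = (\<Sum>m=1..n. \<Sum>k=1..n. if p ^ k dvd m then 1 else 0)"
    using assms by (intro sum.cong) (auto simp: multiplicity_eq_card[where n = n] sum.If_cases Int_def)
  also have "\<dots> = (\<Sum>k=1..n. \<Sum>m=1..n. if p ^ k dvd m then 1 else 0)"
    by (rule sum.swap)
  also have "\<dots> = (\<Sum>k=1..n. n div p ^ k)"
  proof (intro sum.cong refl)
    fix k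
    have "0 < p ^ k" using assms by (simp add: prime_gt_0_nat)
    from card_multiples[OF this, of n]
    show "(\<Sum>m=1..n. if p ^ k dvd m then 1 else 0) = n div p ^ k"
      by (simp add: sum.If_cases Int_def)
  qed
  finally show ?thesis .
qed

lemma sum_multiplicity_le:
  assumes "prime (p::nat)"
  shows "real (\<Sum>m=1..n. multiplicity p m) \<le> real n / (real p - 1)"
proof -
  have p: "real p > 1" using assms prime_gt_1_nat by auto
  have *: "(\<Sum>k=1..N. 1 / real p ^ k) \<le> 1 / (real p - 1)" for N
  proof -
    have "(\<Sum>k=1..N. 1 / real p ^ k) = (1 - 1 / real p ^ N) / (real p - 1)"
    proof (induction N)
      case (Suc N)
      define q where "q = real p ^ N"
      have "q > 0" using p by (simp add: q_def)
      with Suc p show ?case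
        by (simp add: q_def[symmetric] divide_simps) (simp add: algebra_simps)
    qed simp
    also have "\<dots> \<le> 1 / (real p - 1)"
      using p by (intro divide_right_mono) auto
    finally show ?thesis .
  qed
  have "real (\<Sum>m=1..n. multiplicity p m) = (\<Sum>k=1..n. real (n div p ^ k))"
    using assms unfolding sum_multiplicity[OF assms] by simp
  also have "\<dots> \<le> (\<Sum>k=1..n. real n * (1 / real p ^ k))"
  proof (intro sum_mono)
    fix k show "real (n div p ^ k) \<le> real n * (1 / real p ^ k)"
      using of_nat_div_le_of_nat[of n "p ^ k", where ?'a = real] by simp
  qed
  also have "\<dots> \<le> real n * (1 / (real p - 1))"
    unfolding sum_distrib_left[symmetric] using * by (intro mult_left_mono) auto
  finally show ?thesis by simp
qed

lemma sum_multiplicity_ge: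
  assumes "prime (p::nat)" "p \<le> n"
  shows "real n / real p - 1 \<le> real (\<Sum>m=1..n. multiplicity p m)"
proof -
  have p: "p > 1" using assms prime_gt_1_nat by auto
  have "real n / real p - 1 \<le> real (n div p)"
    using floor_divide_of_nat_eq[of n p, where ?'a = real] by linarith
  also have "n div p ^ 1 \<le> (\<Sum>k=1..n. n div p ^ k)"
    using assms p by (intro member_le_sum) auto
  then have "real (n div p) \<le> real (\<Sum>m=1..n. multiplicity p m)"
    using assms(1) by (simp only: sum_multiplicity power_one_right of_nat_le_iff)
  finally show ?thesis .
qed

lemma ln_eq_sum_multiplicity:
  assumes "0 < m" "m \<le> n"
  shows "ln (real m) = (\<Sum>p\<in>primes_upto n. real (multiplicity p m) * ln (real p))"
proof -
  have "real m = real (\<Prod>p\<in>prime_factors m. p ^ multiplicity p m)"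
    using prime_factorization_nat[OF assms(1)] by simp
  also have "\<dots> = (\<Prod>p\<in>prime_factors m. real p ^ multiplicity p m)" by simp
  finally have "ln (real m) = ln (\<Prod>p\<in>prime_factors m. real p ^ multiplicity p m)" by simp
  also have "\<dots> = (\<Sum>p\<in>prime_factors m. ln (real p ^ multiplicity p m))"
    by (intro ln_prod) (auto simp: prime_factors_gt_0_nat)
  also have "\<dots> = (\<Sum>p\<in>prime_factors m. real (multiplicity p m) * ln (real p))"
    by (intro sum.cong refl ln_realpow)
  also have "\<dots> = (\<Sum>p\<in>primes_upto n. real (multiplicity p m) * ln (real p))"
  proof (intro sum.mono_neutral_left)
    show "prime_factors m \<subseteq> primes_upto n"
      using assms by (auto simp: primes_upto_def dest: dvd_imp_le[OF in_prime_factors_imp_dvd])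
    show "\<forall>p\<in>primes_upto n - prime_factors m. real (multiplicity p m) * ln (real p) = 0"
      by (auto simp: primes_upto_def prime_factors_multiplicity)
  qed auto
  finally show ?thesis .
qed

lemma ln_fact_eq_sum_multiplicity:
  "ln (fact n :: real) = (\<Sum>p\<in>primes_upto n. real (\<Sum>m=1..n. multiplicity p m) * ln (real p))"
proof -
  have "ln (fact n :: real) = ln (\<Prod>m=1..n. real m)" by (simp add: fact_prod)
  also have "\<dots> = (\<Sum>m=1..n. ln (real m))" by (intro ln_prod) auto
  also have "\<dots> = (\<Sum>m=1..n. \<Sum>p\<in>primes_upto n. real (multiplicity p m) * ln (real p))"
    by (intro sum.cong refl ln_eq_sum_multiplicity) auto
  also have "\<dots> = (\<Sum>p\<in>primes_upto n. real (\<Sum>m=1..n. multiplicity p m) * ln (real p))"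
    by (subst sum.swap) (simp add: sum_distrib_right)
  finally show ?thesis .
qed

lemma ln_fact_le: "ln (fact n :: real) \<le> real n * ln (real n)"
proof (cases "n = 0")
  case False
  then have "ln (fact n :: real) \<le> ln (real n ^ n)"
    using fact_le_power[of n, where ?'a = real] by (subst ln_le_cancel_iff) auto
  then show ?thesis using False by (simp add: ln_realpow)
qed simp

lemma ln_Suc_diff_le:
  assumes "0 < n" shows "ln (real (Suc n)) - ln (real n) \<le> 1 / real n"
proof -
  have "ln (real (Suc n)) - ln (real n) = ln (1 + 1 / real n)"
    using assms by (subst ln_divide_pos[symmetric]) (auto simp: field_simps)
  also have "\<dots> \<le> 1 / real n"
    by (rule ln_add_one_self_le_self) simp
  finally show ?thesis .
qed

lemma ln_Suc_diff_le_1: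
  assumes "0 < n" shows "ln (real (Suc n)) - ln (real n) \<le> 1"
proof -
  have "1 / real n \<le> 1" using assms by simp
  with ln_Suc_diff_le[OF assms] show ?thesis by linarith
qed

lemma ln_fact_ge: "real n * ln (real n) - real n \<le> ln (fact n :: real)"
proof (induction n)
  case (Suc n)
  show ?case
  proof (cases "n = 0")
    case False
    have "real n * (ln (real (Suc n)) - ln (real n)) \<le> real n * (1 / real n)"
      using False by (intro mult_left_mono ln_Suc_diff_le) auto
    moreover have "ln (fact (Suc n) :: real) = ln (real (Suc n)) + ln (fact n)"
      by (simp add: ln_mult del: of_nat_Suc)
    ultimately show ?thesis using Suc False by (simp add: algebra_simps)
  qed simp
qed simp

text \<open>The subtracted terms imitate the tail integral of ln x / x^2, namely (ln x + 1) / x;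
  with them the induction closes.\<close>

lemma sum_ln_over_consecutive_le:
  assumes "1 \<le> n"
  shows "(\<Sum>m=2..n. ln (real m) / (real m * (real m - 1))) \<le> 3 - ln (real (Suc n)) / real n - 1 / real n"
  using assms
proof (induction n rule: nat_induct_at_least)
  case base
  then show ?case using ln_le_minus_one[of "2::real"] by simp
next
  case (Suc n)
  define x where "x = real n"
  have x: "x \<ge> 1" using Suc by (simp add: x_def)
  have "ln (x + 2) - ln (x + 1) \<le> 1 / (x + 1)"
    using ln_Suc_diff_le[of "Suc n"] by (simp add: x_def add.commute)
  then have "ln (x + 2) / (x + 1) \<le> (ln (x + 1) + 1 / (x + 1)) / (x + 1)"
    using x by (intro divide_right_mono) auto
  moreover have "(ln (x + 1) + 1 / (x + 1)) / (x + 1) + ln (x + 1) / (x * (x + 1))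
      = ln (x + 1) / x + 1 / (x + 1)\<^sup>2"
    using x by (simp add: divide_simps) (simp add: algebra_simps power2_eq_square)
  moreover have "1 / (x + 1)\<^sup>2 \<le> 1 / x - 1 / (x + 1)"
  proof -
    have "1 / (x + 1)\<^sup>2 \<le> 1 / (x * (x + 1))"
      using x by (intro divide_left_mono) (auto simp: power2_eq_square)
    also have "\<dots> = 1 / x - 1 / (x + 1)" using x by (simp add: field_simps)
    finally show ?thesis .
  qed
  ultimately have "ln (x + 1) / (x * (x + 1)) \<le> ln (x + 1) / x + 1 / x - ln (x + 2) / (x + 1) - 1 / (x + 1)"
    by linarith
  then have "ln (real (Suc n)) / (real (Suc n) * (real (Suc n) - 1))
     \<le> ln (real (Suc n)) / real n + 1 / real n - ln (real (Suc (Suc n))) / real (Suc n) - 1 / real (Suc n)"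
    by (simp add: x_def algebra_simps)
  then show ?case using Suc by simp
qed

text \<open>Two evaluations of ln (n!) are compared: Legendre's formula, and n ln n up to an error
  n. The rounding in Legendre's formula costs at most \<open>theta n \<le> 4 * n\<close> in one
  direction; the prime powers beyond the first cost at most 3 n in the other.\<close>

lemma mertens_first:
  assumes "1 \<le> n"
  shows "\<bar>(\<Sum>p\<in>primes_upto n. ln (real p) / real p) - ln (real n)\<bar> \<le> 4"
proof -
  define A where "A = (\<Sum>p\<in>primes_upto n. ln (real p) / real p)"
  have n: "0 < real n" using assms by simp
  have lnp: "0 \<le> ln (real p)" if "p \<in> primes_upto n" for p
    using that by (auto dest: primes_uptoD)
  have "real n * A - theta n = (\<Sum>p\<in>primes_upto n. (real n / real p - 1) * ln (real p))"
    by (simp add: A_def theta_def sum_distrib_left left_diff_distrib sum_subtractf)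
  also have "\<dots> \<le> (\<Sum>p\<in>primes_upto n. real (\<Sum>m=1..n. multiplicity p m) * ln (real p))"
    by (intro sum_mono mult_right_mono sum_multiplicity_ge lnp) (auto dest: primes_uptoD)
  also have "\<dots> \<le> real n * ln (real n)"
    using ln_fact_le[of n] by (simp only: ln_fact_eq_sum_multiplicity)
  finally have "real n * A \<le> real n * (ln (real n) + 4)"
    using theta_le[of n] by (simp add: algebra_simps)
  then have up: "A \<le> ln (real n) + 4" using n by (simp only: mult_le_cancel_left_pos)
  have "real n * ln (real n) - real n \<le> (\<Sum>p\<in>primes_upto n. real (\<Sum>m=1..n. multiplicity p m) * ln (real p))"
    using ln_fact_ge[of n] by (simp only: ln_fact_eq_sum_multiplicity)
  also have "\<dots> \<le> (\<Sum>p\<in>primes_upto n. real n / (real p - 1) * ln (real p))"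
    by (intro sum_mono mult_right_mono sum_multiplicity_le lnp) (auto dest: primes_uptoD)
  also have "\<dots> = (\<Sum>p\<in>primes_upto n. real n * (ln (real p) / real p + ln (real p) / (real p * (real p - 1))))"
  proof (intro sum.cong refl)
    fix p assume "p \<in> primes_upto n"
    then have "real p \<ge> 2" by (auto dest: primes_uptoD)
    then show "real n / (real p - 1) * ln (real p)
        = real n * (ln (real p) / real p + ln (real p) / (real p * (real p - 1)))"
      by (simp add: divide_simps) (simp add: algebra_simps)
  qed
  also have "\<dots> = real n * (A + (\<Sum>p\<in>primes_upto n. ln (real p) / (real p * (real p - 1))))"
    by (simp add: A_def sum.distrib flip: sum_distrib_left)
  also have "(\<Sum>p\<in>primes_upto n. ln (real p) / (real p * (real p - 1)))
      \<le> (\<Sum>m=2..n. ln (real m) / (real m * (real m - 1)))"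
    by (intro sum_mono2) (auto dest: primes_uptoD)
  also have "\<dots> \<le> 3"
  proof -
    have "0 \<le> ln (real (Suc n)) / real n" "0 \<le> 1 / real n" by (auto intro!: divide_nonneg_nonneg)
    with sum_ln_over_consecutive_le[OF assms] show ?thesis by linarith
  qed
  finally have "real n * (ln (real n) - 1) \<le> real n * (A + 3)"
    using n by (simp add: right_diff_distrib)
  then have "ln (real n) - 1 \<le> A + 3" using n by (simp only: mult_le_cancel_left_pos)
  with up show ?thesis by (simp add: A_def)
qed

text \<open>Partial summation against Mertens' first theorem: the error of each step is at most five times
  \<open>1 / ln m - 1 / ln (m + 1)\<close>, so the errors telescope.\<close>
lemma mertens_second_aux:
  assumes "1 \<le> n"
  defines "A \<equiv> \<lambda>n. \<Sum>p\<in>primes_upto n. ln (real p) / real p"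
  shows "\<bar>(\<Sum>p\<in>primes_upto n. 1 / real p) - A n / ln (real (Suc n)) - (ln (ln (real (Suc n))) - ln (ln 2))\<bar>
    \<le> 5 * (1 / ln 2 - 1 / ln (real (Suc n)))"
  using assms(1)
proof (induction n rule: nat_induct_at_least)
  case base
  then show ?case by (simp add: A_def)
next
  case (Suc n)
  define a where "a = ln (real (Suc n))"
  define b where "b = ln (real (Suc (Suc n)))"
  have a: "0 < a" and ab: "a < b" using Suc by (auto simp: a_def b_def)
  have b: "0 < b" using a ab by simp
  have ba: "b - a \<le> 1"
    using ln_Suc_diff_le_1[of "Suc n"] by (simp add: a_def b_def)
  have "(\<Sum>p\<in>primes_upto (Suc n). 1 / real p) = (\<Sum>p\<in>primes_upto n. 1 / real p) + (A (Suc n) - A n) / a"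
    using a by (auto simp: primes_upto_Suc A_def a_def)
  moreover have "(A (Suc n) - a) * (1 / a - 1 / b) = A (Suc n) / a - 1 - A (Suc n) / b + a / b"
    using a b by (simp add: right_diff_distrib left_diff_distrib diff_divide_distrib)
  \<comment> \<open>The increment of the error has two parts: Mertens' error
    \<open>A (Suc n) - a\<close>, at most 4, times \<open>1 / a - 1 / b\<close>; and the discrepancy
    between \<open>1 - a / b\<close> and \<open>ln b - ln a\<close>, which costs one more such
    difference. Hence the constant 5.\<close>
  ultimately have eq: "(\<Sum>p\<in>primes_upto (Suc n). 1 / real p) - A (Suc n) / b - (ln b - ln (ln 2))
    = ((\<Sum>p\<in>primes_upto n. 1 / real p) - A n / a - (ln a - ln (ln 2)))
      + ((A (Suc n) - a) * (1 / a - 1 / b) + ((1 - a / b) - (ln b - ln a)))"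
    by (simp add: diff_divide_distrib)
  have 1: "\<bar>(A (Suc n) - a) * (1 / a - 1 / b)\<bar> \<le> 4 * (1 / a - 1 / b)"
    unfolding abs_mult using a ab mertens_first[of "Suc n"]
    by (intro mult_mono) (auto simp: A_def a_def frac_le)
  have u1: "ln a - ln b \<le> a / b - 1"
    using ln_le_minus_one[of "a / b"] a b by (simp add: ln_divide_pos)
  have u2: "ln b - ln a \<le> b / a - 1"
    using ln_le_minus_one[of "b / a"] a b by (simp add: ln_divide_pos)
  have "b / a - 1 - (1 - a / b) = (b - a) * (1 / a - 1 / b)"
    using a b by (simp add: field_simps)
  also have "\<dots> \<le> 1 * (1 / a - 1 / b)"
    using a ab ba by (intro mult_right_mono) (auto simp: frac_le)
  finally have 2: "\<bar>(1 - a / b) - (ln b - ln a)\<bar> \<le> 1 / a - 1 / b"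
    using u1 u2 unfolding mult_1 abs_le_iff by linarith
  have IH: "\<bar>(\<Sum>p\<in>primes_upto n. 1 / real p) - A n / a - (ln a - ln (ln 2))\<bar> \<le> 5 * (1 / ln 2 - 1 / a)"
    using Suc.IH by (simp only: a_def)
  have tri: "\<bar>x + (y + z)\<bar> \<le> 5 * (l - v)"
    if "\<bar>x\<bar> \<le> 5 * (l - u)" "\<bar>y\<bar> \<le> 4 * (u - v)" "\<bar>z\<bar> \<le> u - v" for x y z l u v :: real
    using that unfolding abs_le_iff by (simp add: algebra_simps)
  show ?case
    unfolding a_def[symmetric] b_def[symmetric] eq by (rule tri[OF IH 1 2])
qed

text \<open>Two corrections to the partial summation remain: the term \<open>A / b\<close> is
  bounded by Mertens' first theorem, and moving the argument from n + 1 back to n changes ln ln by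
  at most 1 / ln 2.\<close>

lemma mertens_second:
  obtains C where "\<And>n. 2 \<le> n \<Longrightarrow> \<bar>(\<Sum>p\<in>primes_upto n. 1 / real p) - ln (ln (real n))\<bar> \<le> C"
proof
  fix n :: nat assume n: "2 \<le> n"
  define A where "A = (\<Sum>p\<in>primes_upto n. ln (real p) / real p)"
  define a where "a = ln (real n)"
  define b where "b = ln (real (Suc n))"
  have l2: "0 < ln (2::real)" "ln 2 \<le> a" "a < b" using n by (auto simp: a_def b_def)
  have a0: "0 < a" and b0: "0 < b" using l2 by linarith+
  have ba: "b - a \<le> 1"
    using ln_Suc_diff_le_1[of n] n by (simp add: a_def b_def)
  have 1: "\<bar>(\<Sum>p\<in>primes_upto n. 1 / real p) - A / b - (ln b - ln (ln 2))\<bar> \<le> 5 * (1 / ln 2)"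
  proof -
    have "\<bar>(\<Sum>p\<in>primes_upto n. 1 / real p) - A / b - (ln b - ln (ln 2))\<bar> \<le> 5 * (1 / ln 2 - 1 / b)"
      unfolding A_def b_def by (rule mertens_second_aux) (use n in simp)
    also have "\<dots> \<le> 5 * (1 / ln 2)" using b0 by (simp add: algebra_simps)
    finally show ?thesis .
  qed
  have "\<bar>A - a\<bar> \<le> 4" using mertens_first[of n] n by (simp add: A_def a_def)
  then have "\<bar>A\<bar> \<le> b + 4" using a0 l2 by linarith
  then have "\<bar>A\<bar> / b \<le> (b + 4) / b" using b0 by (intro divide_right_mono) auto
  also have "\<dots> = 1 + 4 * (1 / b)" using b0 by (simp add: field_simps)
  also have "\<dots> \<le> 1 + 4 * (1 / ln 2)" using l2 b0 by (simp add: frac_le)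
  finally have 2: "\<bar>A / b\<bar> \<le> 1 + 4 * (1 / ln 2)" using b0 by simp
  have "ln b - ln a \<le> (b - a) / a"
    using ln_le_minus_one[of "b / a"] a0 b0 by (simp add: ln_divide_pos diff_divide_distrib)
  also have "\<dots> \<le> 1 / ln 2" using l2 ba a0 by (intro frac_le) auto
  finally have "ln b - ln a \<le> 1 / ln 2" .
  moreover have "ln a \<le> ln b" using a0 b0 l2(3) by (subst ln_le_cancel_iff) auto
  ultimately have 3: "\<bar>ln b - ln a\<bar> \<le> 1 / ln 2" by simp
  have tri: "\<bar>s - x\<bar> \<le> 1 + 10 * k + \<bar>z\<bar>"
    if "\<bar>s - q - (y - z)\<bar> \<le> 5 * k" "\<bar>q\<bar> \<le> 1 + 4 * k" "\<bar>y - x\<bar> \<le> k" for s x q y z k :: real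
    using that by linarith
  show "\<bar>(\<Sum>p\<in>primes_upto n. 1 / real p) - ln (ln (real n))\<bar> \<le> 1 + 10 * (1 / ln 2) + \<bar>ln (ln 2)\<bar>"
    unfolding a_def[symmetric] by (rule tri[OF 1 2 3])
qed

section \<open>The Gauss measure and its transfer operator\<close>

definition gauss_density :: "real \<Rightarrow> real" where
  "gauss_density x = indicator {0..1} x / (ln 2 * (1 + x))"

definition gauss_measure :: "real measure" where
  "gauss_measure = density lborel (\<lambda>x. ennreal (gauss_density x))"

definition branch :: "nat \<Rightarrow> real set" where
  "branch k = {1 / (real k + 1) <.. 1 / real k}"

text \<open>With \<open>h x = 1 / (1 + x)\<close> and \<open>z = 1 / (x + k)\<close> this is \<open>z\<^sup>2 h z / h x\<close>, the weight of the
  \<open>k\<close>-th inverse branch in the transfer operator with respect to the Gauss measure.\<close>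
definition branch_weight :: "nat \<Rightarrow> real \<Rightarrow> real" where
  "branch_weight k x = (x + 1) / ((x + real k) * (x + real k + 1))"

lemma branch_iff:
  assumes "0 < k" shows "x \<in> branch k \<longleftrightarrow> nat \<lfloor>1 / x\<rfloor> = k"
proof (cases "0 < x")
  case True
  have "nat \<lfloor>1 / x\<rfloor> = k \<longleftrightarrow> \<lfloor>1 / x\<rfloor> = int k" using assms by linarith
  also have "\<dots> \<longleftrightarrow> real k \<le> 1 / x \<and> 1 / x < real k + 1" by (simp add: floor_eq_iff)
  also have "\<dots> \<longleftrightarrow> x \<in> branch k"
    using True assms by (auto simp: branch_def field_simps)
  finally show ?thesis ..
next
  case False
  then have "\<lfloor>1 / x\<rfloor> \<le> 0" by (simp add: divide_nonpos_nonneg floor_le_iff) (smt (verit) divide_nonneg_nonpos)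
  moreover have "0 < 1 / (real k + 1)" by simp
  then have "x \<notin> branch k" using False unfolding branch_def greaterThanAtMost_iff by linarith
  ultimately show ?thesis using assms by auto
qed

lemma branch_subset: "0 < k \<Longrightarrow> branch k \<subseteq> {0<..1}"
proof
  fix x assume k: "0 < k" and x: "x \<in> branch k"
  have "0 < 1 / (real k + 1)" by simp
  also have "\<dots> < x" using x by (simp add: branch_def)
  finally have "0 < x" .
  moreover have "x \<le> 1 / real k" using x by (simp add: branch_def)
  moreover have "1 / real k \<le> 1" using k by simp
  ultimately show "x \<in> {0<..1}" by simp
qed

lemma disjoint_branches: "disjoint_family (\<lambda>k. branch (Suc k))"
  unfolding disjoint_family_on_def using branch_iff[OF zero_less_Suc] by auto

lemma Union_branches: "(\<Union>k. branch (Suc k)) = {0<..1}"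
proof (intro equalityI subsetI)
  fix x :: real assume "x \<in> {0<..1}"
  then have "1 \<le> \<lfloor>1 / x\<rfloor>" by (simp add: le_floor_iff)
  then have "nat \<lfloor>1 / x\<rfloor> = Suc (nat \<lfloor>1 / x\<rfloor> - 1)" by linarith
  then show "x \<in> (\<Union>k. branch (Suc k))" using branch_iff[OF zero_less_Suc] by blast
qed (use branch_subset in blast)

lemma branch_measurable [measurable]: "branch k \<in> sets borel"
  unfolding branch_def by simp

lemma gauss_density_measurable [measurable]: "gauss_density \<in> borel_measurable borel"
  unfolding gauss_density_def by measurable

lemma branch_weight_measurable [measurable]: "branch_weight k \<in> borel_measurable borel"
  unfolding branch_weight_def by measurable

lemma gauss_map_measurable [measurable]: "gauss_map \<in> borel_measurable borel"
  unfolding gauss_map_def by measurable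

lemma gauss_map_funpow_measurable [measurable]: "gauss_map ^^ n \<in> borel_measurable borel"
proof (induction n)
  case (Suc n)
  then show ?case unfolding funpow.simps by (rule measurable_comp) measurable
qed (simp add: id_def)

lemma gauss_density_nonneg: "0 \<le> gauss_density x"
  by (simp add: gauss_density_def indicator_def)

lemma sets_gauss_measure [measurable_cong, simp]: "sets gauss_measure = sets borel"
  by (simp add: gauss_measure_def)

lemma space_gauss_measure [simp]: "space gauss_measure = UNIV"
  by (simp add: gauss_measure_def)

lemma nn_integral_gauss:
  "f \<in> borel_measurable borel \<Longrightarrow>
    (\<integral>\<^sup>+x. f x \<partial>gauss_measure) = (\<integral>\<^sup>+x. ennreal (gauss_density x) * f x \<partial>lborel)"
  unfolding gauss_measure_def by (subst nn_integral_density) auto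

lemma AE_gauss_iff: "(AE x in gauss_measure. P x) \<longleftrightarrow> (AE x in lborel. x \<in> {0..1} \<longrightarrow> P x)"
proof -
  have "0 < ennreal (gauss_density x) \<longleftrightarrow> x \<in> {0..1}" for x
    by (auto simp: gauss_density_def indicator_def)
  then show ?thesis unfolding gauss_measure_def by (subst AE_density) auto
qed

text \<open>Both endpoints are removed: 0 lies in no branch with positive index, and the Gauss map
  inverts \<open>1 / (y + real k)\<close> only for y < 1.\<close>

lemma AE_gauss_lessThan: "AE x in gauss_measure. 0 < x \<and> x < 1"
  unfolding AE_gauss_iff using AE_lborel_singleton[of 0] AE_lborel_singleton[of "1::real"] by eventually_elim auto

lemma prob_space_gauss: "prob_space gauss_measure"
proof
  have "emeasure gauss_measure (space gauss_measure) = (\<integral>\<^sup>+x. ennreal (1 / (ln 2 * (1 + x))) * indicator {0..1} x \<partial>lborel)"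
    unfolding gauss_measure_def by (subst emeasure_density)
      (auto intro!: nn_integral_cong simp: gauss_density_def indicator_def)
  also have "\<dots> = ennreal (ln (1 + 1) / ln 2 - ln (1 + 0) / ln (2::real))"
    by (rule nn_integral_FTC_Icc) (auto intro!: derivative_eq_intros simp: divide_simps)
  finally show "emeasure gauss_measure (space gauss_measure) = 1" by simp
qed

interpretation gauss: prob_space gauss_measure
  by (rule prob_space_gauss)

lemma branch_weight_nonneg: "0 \<le> x \<Longrightarrow> 0 \<le> branch_weight k x"
  by (simp add: branch_weight_def)

text \<open>The left side is the Gauss density pulled back along the inverse branch, with its
  Jacobian; the identity says that the Gauss measure restricted to the branch has density
  \<open>branch_weight k\<close> after this change of variable.\<close>

lemma gauss_density_branch:
  assumes "0 < k" "y \<in> {0..1}"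
  shows "gauss_density (1 / (real k + y)) / (real k + y)\<^sup>2 = gauss_density y * branch_weight k y"
proof -
  define z where "z = real k + y"
  have z: "1 \<le> z" using assms by (simp add: z_def)
  then have "gauss_density (1 / z) / z\<^sup>2 = 1 / (ln 2 * (z * (z + 1)))"
    by (simp add: gauss_density_def power2_eq_square divide_simps)
  moreover have "gauss_density y * branch_weight k y = 1 / (ln 2 * (z * (z + 1)))"
    using assms z by (simp add: gauss_density_def branch_weight_def z_def divide_simps) (simp add: algebra_simps)
  ultimately show ?thesis by (simp add: z_def)
qed

lemma nn_integral_gauss_branch:
  assumes [measurable]: "F \<in> borel_measurable borel" and k: "0 < k"
  shows "(\<integral>\<^sup>+x. F x * indicator (branch k) x \<partial>gauss_measure)
       = (\<integral>\<^sup>+y. ennreal (branch_weight k y) * F (1 / (y + real k)) \<partial>gauss_measure)"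
proof -
  \<comment> \<open>The inverse branch 1 / (k + y) is decreasing, whereas the substitution rule
    wants an increasing map; hence the reflection z = -y, which is undone by an affine substitution
    afterwards.\<close>
  define g :: "real \<Rightarrow> real" where "g = (\<lambda>z. 1 / (real k - z))"
  define H where "H = (\<lambda>x. ennreal (gauss_density x) * F x)"
  have [measurable]: "H \<in> borel_measurable borel" unfolding H_def by measurable
  have "(\<integral>\<^sup>+x. F x * indicator (branch k) x \<partial>gauss_measure) = (\<integral>\<^sup>+x. H x * indicator (branch k) x \<partial>lborel)"
    by (subst nn_integral_gauss) (auto simp: H_def mult.assoc)
  also have "\<dots> = (\<integral>\<^sup>+x. H x * indicator {g (-1)..g 0} x \<partial>lborel)"
  proof (rule nn_integral_cong_AE)
    show "AE x in lborel. H x * indicator (branch k) x = H x * indicator {g (-1)..g 0} x"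
      using AE_lborel_singleton[of "1 / (real k + 1)"]
      by eventually_elim (auto simp: branch_def g_def indicator_def)
  qed
  also have "\<dots> = (\<integral>\<^sup>+z. H (g z) * ennreal (1 / (real k - z)\<^sup>2) * indicator {-1..0} z \<partial>lborel)"
  proof (rule nn_integral_substitution_aux)
    fix z :: real assume "z \<in> {-1..0}"
    then have "real k - z \<noteq> 0" using k by auto
    then show "(g has_real_derivative 1 / (real k - z)\<^sup>2) (at z)"
      unfolding g_def by (auto intro!: derivative_eq_intros simp: power2_eq_square)
  next
    show "continuous_on {-1..0} (\<lambda>z. 1 / (real k - z)\<^sup>2)"
      using k by (intro continuous_intros) auto
  qed (auto simp: g_def)
  also have "\<dots> = (\<integral>\<^sup>+y. H (g (- y)) * ennreal (1 / (real k - (- y))\<^sup>2) * indicator {-1..0} (- y) \<partial>lborel)"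
    by (subst nn_integral_real_affine[where c = "-1" and t = 0]) (auto simp: g_def)
  also have "\<dots> = (\<integral>\<^sup>+y. ennreal (gauss_density y) * (ennreal (branch_weight k y) * F (1 / (y + real k))) \<partial>lborel)"
  proof (rule nn_integral_cong)
    fix y :: real
    show "H (g (- y)) * ennreal (1 / (real k - (- y))\<^sup>2) * indicator {-1..0} (- y)
      = ennreal (gauss_density y) * (ennreal (branch_weight k y) * F (1 / (y + real k)))"
    proof (cases "y \<in> {0..1}")
      case True
      have "ennreal (gauss_density (1 / (real k + y))) * ennreal (1 / (real k + y)\<^sup>2)
        = ennreal (gauss_density y) * ennreal (branch_weight k y)"
        using gauss_density_branch[OF k True] True gauss_density_nonneg branch_weight_nonneg
        by (simp flip: ennreal_mult)
      then show ?thesis using True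
        by (simp add: H_def g_def mult_ac add.commute indicator_def)
    next
      case False
      then have "gauss_density y = 0" by (simp add: gauss_density_def)
      then show ?thesis using False by (auto simp: indicator_def)
    qed
  qed
  also have "\<dots> = (\<integral>\<^sup>+y. ennreal (branch_weight k y) * F (1 / (y + real k)) \<partial>gauss_measure)"
    by (subst nn_integral_gauss) auto
  finally show ?thesis .
qed

lemma gauss_map_inverse_branch:
  assumes "0 < k" "0 < y" "y < 1" shows "gauss_map (1 / (y + real k)) = y"
proof -
  have "\<lfloor>y + real k\<rfloor> = int k" using assms by (simp add: floor_eq_iff)
  then show ?thesis by (simp add: gauss_map_def)
qed

lemma nn_integral_gauss_branch_map:
  assumes [measurable]: "f \<in> borel_measurable borel" "g \<in> borel_measurable borel" and k: "0 < k"
  shows "(\<integral>\<^sup>+x. f x * g (gauss_map x) * indicator (branch k) x \<partial>gauss_measure)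
       = (\<integral>\<^sup>+y. ennreal (branch_weight k y) * f (1 / (y + real k)) * g y \<partial>gauss_measure)"
proof (subst nn_integral_gauss_branch[OF _ k])
  show "(\<integral>\<^sup>+y. ennreal (branch_weight k y) * (f (1 / (y + real k)) * g (gauss_map (1 / (y + real k)))) \<partial>gauss_measure)
      = (\<integral>\<^sup>+y. ennreal (branch_weight k y) * f (1 / (y + real k)) * g y \<partial>gauss_measure)"
    using AE_gauss_lessThan
    by (intro nn_integral_cong_AE, eventually_elim) (simp add: gauss_map_inverse_branch k mult.assoc)
qed measurable

text \<open>The duality defining the transfer operator. Working with nonnegative integrals lets the
  sum over the infinitely many branches pass through the integral.\<close>

lemma nn_integral_gauss_transfer:
  assumes [measurable]: "f \<in> borel_measurable borel" "g \<in> borel_measurable borel"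
  shows "(\<integral>\<^sup>+x. f x * g (gauss_map x) \<partial>gauss_measure)
       = (\<integral>\<^sup>+y. (\<Sum>k. ennreal (branch_weight (Suc k) y) * f (1 / (y + real (Suc k)))) * g y \<partial>gauss_measure)"
proof -
  have "(\<integral>\<^sup>+x. f x * g (gauss_map x) \<partial>gauss_measure)
      = (\<integral>\<^sup>+x. (\<Sum>k. f x * g (gauss_map x) * indicator (branch (Suc k)) x) \<partial>gauss_measure)"
  proof (intro nn_integral_cong_AE, use AE_gauss_lessThan in eventually_elim)
    fix x :: real assume "0 < x \<and> x < 1"
    then have "(\<Sum>k. indicator (branch (Suc k)) x) = (1::ennreal)"
      by (subst suminf_indicator[OF disjoint_branches]) (simp add: Union_branches)
    then show "f x * g (gauss_map x) = (\<Sum>k. f x * g (gauss_map x) * indicator (branch (Suc k)) x)"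
      by simp
  qed
  also have "\<dots> = (\<Sum>k. \<integral>\<^sup>+x. f x * g (gauss_map x) * indicator (branch (Suc k)) x \<partial>gauss_measure)"
    by (rule nn_integral_suminf) measurable
  also have "\<dots> = (\<Sum>k. \<integral>\<^sup>+y. ennreal (branch_weight (Suc k) y) * f (1 / (y + real (Suc k))) * g y \<partial>gauss_measure)"
    by (intro suminf_cong nn_integral_gauss_branch_map) auto
  also have "\<dots> = (\<integral>\<^sup>+y. (\<Sum>k. ennreal (branch_weight (Suc k) y) * f (1 / (y + real (Suc k))) * g y) \<partial>gauss_measure)"
    by (rule nn_integral_suminf[symmetric]) measurable
  finally show ?thesis by simp
qed

text \<open>The weight is (y + 1) (1 / (y + k) - 1 / (y + k + 1)), so the sum telescopes. The closed
  form serves twice: its limit 1 gives invariance, and its dependence on y drives the contraction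
  estimate.\<close>

lemma sum_branch_weight:
  assumes "0 \<le> y"
  shows "(\<Sum>k<n. branch_weight (Suc k) y) = real n / (y + real n + 1)"
proof (induction n)
  case (Suc n)
  have "y + real n + 1 > 0" "y + real n + 2 > 0" using assms by auto
  then have "real n / (y + real n + 1) + (y + 1) / ((y + real n + 1) * (y + real n + 2))
      = (real n + 1) / (y + real n + 2)"
    by (simp add: divide_simps) (simp add: algebra_simps)
  with Suc show ?case by (simp add: branch_weight_def add_ac)
qed simp

lemma branch_weight_sums:
  assumes "0 \<le> y" shows "(\<lambda>k. branch_weight (Suc k) y) sums 1"
proof -
  have "(\<lambda>n. real n / (y + real n + 1)) \<longlonglongrightarrow> 1" by real_asymp
  then show ?thesis unfolding sums_def using assms by (simp add: sum_branch_weight)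
qed

text \<open>Invariance is the duality for the constant function 1, which the transfer operator fixes
  because the weights sum to 1.\<close>

lemma nn_integral_gauss_map:
  assumes [measurable]: "g \<in> borel_measurable borel"
  shows "(\<integral>\<^sup>+x. g (gauss_map x) \<partial>gauss_measure) = (\<integral>\<^sup>+x. g x \<partial>gauss_measure)"
proof -
  have "(\<integral>\<^sup>+x. g (gauss_map x) \<partial>gauss_measure) = (\<integral>\<^sup>+x. 1 * g (gauss_map x) \<partial>gauss_measure)" by simp
  also have "\<dots> = (\<integral>\<^sup>+y. (\<Sum>k. ennreal (branch_weight (Suc k) y) * 1) * g y \<partial>gauss_measure)"
    by (rule nn_integral_gauss_transfer) auto
  also have "\<dots> = (\<integral>\<^sup>+y. g y \<partial>gauss_measure)"
  proof (intro nn_integral_cong_AE, use AE_gauss_lessThan in eventually_elim)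
    fix y :: real assume "0 < y \<and> y < 1"
    then have "(\<Sum>k. ennreal (branch_weight (Suc k) y)) = ennreal 1"
      by (intro suminf_ennreal_eq branch_weight_sums) (auto intro: branch_weight_nonneg)
    then show "(\<Sum>k. ennreal (branch_weight (Suc k) y) * 1) * g y = g y" by simp
  qed
  finally show ?thesis .
qed

lemma nn_integral_gauss_map_funpow:
  assumes [measurable]: "g \<in> borel_measurable borel"
  shows "(\<integral>\<^sup>+x. g ((gauss_map ^^ n) x) \<partial>gauss_measure) = (\<integral>\<^sup>+x. g x \<partial>gauss_measure)"
proof (induction n)
  case (Suc n)
  have "(\<integral>\<^sup>+x. g ((gauss_map ^^ Suc n) x) \<partial>gauss_measure)
      = (\<integral>\<^sup>+x. g ((gauss_map ^^ n) (gauss_map x)) \<partial>gauss_measure)"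
    by (simp add: funpow_swap1)
  also have "\<dots> = (\<integral>\<^sup>+x. g ((gauss_map ^^ n) x) \<partial>gauss_measure)"
    by (rule nn_integral_gauss_map) measurable
  finally show ?case using Suc by simp
qed simp

lemma measure_gauss_map_funpow:
  assumes [measurable]: "B \<in> sets borel"
  shows "measure gauss_measure {x. (gauss_map ^^ n) x \<in> B} = measure gauss_measure B"
proof -
  have "emeasure gauss_measure {x. (gauss_map ^^ n) x \<in> B} = (\<integral>\<^sup>+x. indicator B ((gauss_map ^^ n) x) \<partial>gauss_measure)"
  proof -
    have [measurable]: "{x. (gauss_map ^^ n) x \<in> B} \<in> sets borel" by measurable
    have "(\<integral>\<^sup>+x. indicator B ((gauss_map ^^ n) x) \<partial>gauss_measure)
        = (\<integral>\<^sup>+x. indicator {x. (gauss_map ^^ n) x \<in> B} x \<partial>gauss_measure)"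
      by (intro nn_integral_cong) (simp add: indicator_def)
    then show ?thesis by simp
  qed
  also have "\<dots> = emeasure gauss_measure B"
    by (subst nn_integral_gauss_map_funpow) auto
  finally show ?thesis by (simp add: measure_def)
qed

section \<open>Contraction of the transfer operator on Lipschitz functions\<close>

definition transfer_op :: "(real \<Rightarrow> real) \<Rightarrow> real \<Rightarrow> real" where
  "transfer_op f y = (\<Sum>k. branch_weight (Suc k) y * f (1 / (y + real (Suc k))))"

text \<open>Nonnegativity is bundled in because the functions enter nonnegative integrals through
  \<open>ennreal\<close>; it also makes \<open>f 0 + L\<close> a bound for the absolute
  value.\<close>

definition lip01 :: "real \<Rightarrow> (real \<Rightarrow> real) \<Rightarrow> bool" where
  "lip01 L f \<longleftrightarrow> f \<in> borel_measurable borel \<and> (\<forall>x\<in>{0..1}. 0 \<le> f x) \<and>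
     (\<forall>x\<in>{0..1}. \<forall>y\<in>{0..1}. \<bar>f x - f y\<bar> \<le> L * \<bar>x - y\<bar>)"

lemma lip01_nonneg: "lip01 L f \<Longrightarrow> x \<in> {0..1} \<Longrightarrow> 0 \<le> f x"
  by (simp add: lip01_def)

lemma lip01D: "lip01 L f \<Longrightarrow> x \<in> {0..1} \<Longrightarrow> y \<in> {0..1} \<Longrightarrow> \<bar>f x - f y\<bar> \<le> L * \<bar>x - y\<bar>"
  by (simp add: lip01_def)

lemma lip01_const_nonneg: "lip01 L f \<Longrightarrow> 0 \<le> L"
  using lip01D[of L f 0 1] by simp

lemma lip01_bound:
  assumes "lip01 L f" "x \<in> {0..1}" shows "f x \<le> f 0 + L"
proof -
  have "\<bar>f x - f 0\<bar> \<le> L * \<bar>x\<bar>" using lip01D[OF assms(1,2), of 0] by simp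
  also have "\<dots> \<le> L * 1"
    using lip01_const_nonneg[OF assms(1)] assms(2) by (intro mult_left_mono) auto
  finally show ?thesis by simp
qed

lemma inverse_branch_mem: "0 \<le> y \<Longrightarrow> 1 / (y + real (Suc k)) \<in> {0..1::real}"
  by simp

lemma summable_transfer_op:
  assumes "lip01 L f" "0 \<le> y"
  shows "summable (\<lambda>k. branch_weight (Suc k) y * f (1 / (y + real (Suc k))))"
proof (rule summable_comparison_test')
  show "summable (\<lambda>k. branch_weight (Suc k) y * (f 0 + L))"
    using branch_weight_sums[OF assms(2)] by (intro summable_mult2) (rule sums_summable)
  fix k :: nat
  have "\<bar>f (1 / (y + real (Suc k)))\<bar> \<le> f 0 + L"
    using lip01_bound[OF assms(1) inverse_branch_mem[OF assms(2)]]
      lip01_nonneg[OF assms(1) inverse_branch_mem[OF assms(2)]] by simp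
  then show "norm (branch_weight (Suc k) y * f (1 / (y + real (Suc k)))) \<le> branch_weight (Suc k) y * (f 0 + L)"
    using branch_weight_nonneg[OF assms(2)] by (simp add: abs_mult mult_left_mono del: of_nat_Suc)
qed

lemma summation_by_parts:
  fixes q a :: "nat \<Rightarrow> real"
  assumes "q 0 = 0"
  shows "(\<Sum>k<n. (q (Suc k) - q k) * a k) = q n * a n - (\<Sum>k<n. q (Suc k) * (a (Suc k) - a k))"
  using assms by (induction n) (auto simp: algebra_simps)

text \<open>Since (m + 1) (m + 3) < (m + 2)^2, each cube is dominated by a product of three
  consecutive numbers, whose reciprocals telescope to a total of 1 / 4.\<close>

lemma sum_inverse_cube_le:
  "(\<Sum>k<n. 1 / (real k + 2) ^ 3) \<le> (1 / 4 :: real)"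
proof -
  have "(\<Sum>k<n. 1 / (real k + 2) ^ 3) \<le> 1 / 4 - 1 / (2 * ((real n + 1) * (real n + 2)))"
  proof (induction n)
    case (Suc n)
    define m where "m = real n"
    have m: "0 \<le> m" by (simp add: m_def)
    have "1 / (m + 2) ^ 3 \<le> 1 / ((m + 1) * (m + 2) * (m + 3))"
      using m by (intro divide_left_mono mult_pos_pos zero_less_power) (auto simp: power3_eq_cube algebra_simps)
    also have "\<dots> = 1 / (2 * ((m + 1) * (m + 2))) - 1 / (2 * ((m + 2) * (m + 3)))"
      using m by (simp add: divide_simps)
    finally show ?case using Suc by (simp add: m_def add_ac)
  qed simp
  also have "\<dots> \<le> 1 / 4" by simp
  finally show ?thesis .
qed

text \<open>The first branch is kept apart, as its inverse 1 / (1 + x) does not contract near 0;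
  only its weight helps. On all others the denominators are at least 4 and the weights sum to at
  most 1 - 1 / (y + 2). The bound 5 / 8 = 1 / 2 + 1 / 8 is the case y = 0.\<close>

lemma sum_branch_contraction_le:
  fixes x y :: real
  assumes "0 \<le> x" "0 \<le> y"
  shows "(\<Sum>k<n. branch_weight (Suc k) y / ((x + real (Suc k)) * (y + real (Suc k)))) \<le> 5 / 8"
proof (cases n)
  case (Suc m)
  have "(\<Sum>k<n. branch_weight (Suc k) y / ((x + real (Suc k)) * (y + real (Suc k))))
     = branch_weight 1 y / ((x + 1) * (y + 1))
       + (\<Sum>k<m. branch_weight (Suc (Suc k)) y / ((x + real (Suc (Suc k))) * (y + real (Suc (Suc k)))))"
    unfolding Suc by (subst sum.lessThan_Suc_shift) simp
  also have "branch_weight 1 y / ((x + 1) * (y + 1)) \<le> branch_weight 1 y / (1 * (y + 1))"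
    using assms by (intro divide_left_mono mult_right_mono branch_weight_nonneg) auto
  also have "\<dots> = 1 / ((y + 1) * (y + 2))"
    using assms by (simp add: branch_weight_def add_ac)
  also have "(\<Sum>k<m. branch_weight (Suc (Suc k)) y / ((x + real (Suc (Suc k))) * (y + real (Suc (Suc k)))))
      \<le> (\<Sum>k<m. branch_weight (Suc (Suc k)) y / (2 * 2))"
    using assms by (intro sum_mono divide_left_mono mult_mono branch_weight_nonneg mult_pos_pos) auto
  also have "\<dots> = ((\<Sum>k<Suc m. branch_weight (Suc k) y) - branch_weight 1 y) / 4"
    by (subst sum.lessThan_Suc_shift) (simp add: sum_divide_distrib)
  also have "\<dots> \<le> (1 - 1 / (y + 2)) / 4"
  proof -
    have "real (Suc m) / (y + real (Suc m) + 1) \<le> 1" using assms by simp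
    moreover have "branch_weight 1 y = 1 / (y + 2)" using assms by (simp add: branch_weight_def add_ac)
    ultimately show ?thesis unfolding sum_branch_weight[OF assms(2)] by (intro divide_right_mono) linarith+
  qed
  also have "1 / ((y + 1) * (y + 2)) + (1 - 1 / (y + 2)) / 4 \<le> 5 / 8"
  proof -
    have "8 * (4 + (y + 1)\<^sup>2) \<le> 20 * ((y + 1) * (y + 2))"
      using assms by (simp add: power2_eq_square algebra_simps)
    moreover have "1 / ((y + 1) * (y + 2)) + (1 - 1 / (y + 2)) / 4 = (4 + (y + 1)\<^sup>2) / (4 * ((y + 1) * (y + 2)))"
      using assms by (simp add: divide_simps) (simp add: power2_eq_square algebra_simps)
    ultimately show ?thesis using assms by (simp add: divide_le_eq)
  qed
  finally show ?thesis by simp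
qed simp

text \<open>The difference splits into a part where only the weights change and a part where only the
  arguments of \<open>f\<close> change. In the first part the partial sums of the weights are explicit, and
  summation by parts gives the constant \<open>1 / 4\<close>; the second part contributes \<open>5 / 8\<close>.\<close>
lemma transfer_op_contraction:
  assumes f: "lip01 L f" and x: "x \<in> {0..1}" and y: "y \<in> {0..1}"
  shows "\<bar>transfer_op f x - transfer_op f y\<bar> \<le> (7 / 8 * L) * \<bar>x - y\<bar>"
proof -
  have L: "0 \<le> L" by (rule lip01_const_nonneg[OF f])
  have x0: "0 \<le> x" and y0: "0 \<le> y" using x y by auto
  \<comment> \<open>\<open>q n\<close> is the difference of the first n weights' sums at
    \<open>x\<close> and at \<open>y\<close>, so its increments are exactly the differences of the
    weights.\<close>
  define q where "q n = real n / (x + real n + 1) - real n / (y + real n + 1)" for n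
  define a where "a k = f (1 / (x + real (Suc k)))" for k
  define b where "b k = f (1 / (y + real (Suc k)))" for k
  have q_Suc: "q (Suc k) - q k = branch_weight (Suc k) x - branch_weight (Suc k) y" for k
    using sum_branch_weight[OF x0, of "Suc k"] sum_branch_weight[OF y0, of "Suc k"]
      sum_branch_weight[OF x0, of k] sum_branch_weight[OF y0, of k]
    by (simp add: q_def)
  have q_eq: "\<bar>q k\<bar> = real k * \<bar>x - y\<bar> / ((x + real k + 1) * (y + real k + 1))" for k
  proof -
    have "q k = real k * (y - x) / ((x + real k + 1) * (y + real k + 1))"
      using x0 y0 unfolding q_def by (simp add: divide_simps) (simp add: algebra_simps)
    then show ?thesis using x0 y0 by (simp add: abs_mult abs_minus_commute)
  qed
  \<comment> \<open>Up to the factors \<open>\<bar>x - y\<bar>\<close> and \<open>L\<close>, with m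
    = k + 1, the first factor is at most m / (m + 1)^2 and the second at most 1 / (m (m + 1)); their
    product is the inverse cube.\<close>
  have step: "\<bar>q (Suc k) * (a (Suc k) - a k)\<bar> \<le> L * \<bar>x - y\<bar> * (1 / (real k + 2) ^ 3)" for k
  proof -
    define m where "m = real k + 1"
    have m: "1 \<le> m" by (simp add: m_def)
    have "\<bar>a (Suc k) - a k\<bar> \<le> L * \<bar>1 / (x + real (Suc (Suc k))) - 1 / (x + real (Suc k))\<bar>"
      unfolding a_def using x0 by (intro lip01D[OF f] inverse_branch_mem)
    also have "\<bar>1 / (x + real (Suc (Suc k))) - 1 / (x + real (Suc k))\<bar> = 1 / ((x + m) * (x + m + 1))"
    proof -
      have "1 / (x + real (Suc (Suc k))) - 1 / (x + real (Suc k)) = - (1 / ((x + m) * (x + m + 1)))"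
        using x0 unfolding m_def by (simp add: divide_simps) (simp add: algebra_simps)
      then show ?thesis using x0 m by simp
    qed
    also have "\<dots> \<le> 1 / (m * (m + 1))"
      using x0 m by (intro divide_left_mono mult_mono mult_pos_pos) auto
    finally have A: "\<bar>a (Suc k) - a k\<bar> \<le> L * (1 / (m * (m + 1)))" using L by (simp add: mult_left_mono)
    have "\<bar>q (Suc k)\<bar> = m * \<bar>x - y\<bar> / ((x + m + 1) * (y + m + 1))"
      unfolding q_eq by (simp add: m_def add_ac)
    also have "\<dots> \<le> m * \<bar>x - y\<bar> / ((m + 1) * (m + 1))"
      using x0 y0 m by (intro divide_left_mono mult_mono mult_pos_pos mult_nonneg_nonneg) auto
    finally have Q: "\<bar>q (Suc k)\<bar> \<le> m * \<bar>x - y\<bar> / ((m + 1) * (m + 1))" .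
    have "\<bar>q (Suc k) * (a (Suc k) - a k)\<bar> \<le> (m * \<bar>x - y\<bar> / ((m + 1) * (m + 1))) * (L * (1 / (m * (m + 1))))"
      unfolding abs_mult using A Q m by (intro mult_mono) auto
    also have "\<dots> = L * \<bar>x - y\<bar> * (1 / (m + 1) ^ 3)"
      using m by (simp add: power3_eq_cube mult_ac)
    finally show ?thesis by (simp add: m_def add_ac)
  qed
  \<comment> \<open>Finite sums come first because summation by parts leaves the boundary term
    \<open>q n * a n\<close>. It disappears in the limit, as both quotients in \<open>q n\<close>
    tend to 1.\<close>
  have partial: "\<bar>(\<Sum>k<n. branch_weight (Suc k) x * a k) - (\<Sum>k<n. branch_weight (Suc k) y * b k)\<bar>
      \<le> \<bar>q n\<bar> * (f 0 + L) + (7 / 8 * L) * \<bar>x - y\<bar>" for n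
  proof -
    have "(\<Sum>k<n. branch_weight (Suc k) x * a k) - (\<Sum>k<n. branch_weight (Suc k) y * b k)
       = (\<Sum>k<n. (q (Suc k) - q k) * a k) + (\<Sum>k<n. branch_weight (Suc k) y * (a k - b k))"
      unfolding q_Suc by (simp add: algebra_simps flip: sum_subtractf sum.distrib)
    also have "(\<Sum>k<n. (q (Suc k) - q k) * a k) = q n * a n - (\<Sum>k<n. q (Suc k) * (a (Suc k) - a k))"
      by (rule summation_by_parts) (simp add: q_def)
    finally have eq: "(\<Sum>k<n. branch_weight (Suc k) x * a k) - (\<Sum>k<n. branch_weight (Suc k) y * b k)
       = q n * a n - (\<Sum>k<n. q (Suc k) * (a (Suc k) - a k)) + (\<Sum>k<n. branch_weight (Suc k) y * (a k - b k))" .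
    have "a n \<le> f 0 + L" "0 \<le> a n" unfolding a_def
      using lip01_bound[OF f inverse_branch_mem[OF x0]] lip01_nonneg[OF f inverse_branch_mem[OF x0]] by auto
    then have 1: "\<bar>q n * a n\<bar> \<le> \<bar>q n\<bar> * (f 0 + L)"
      by (simp add: abs_mult mult_left_mono)
    have "\<bar>\<Sum>k<n. q (Suc k) * (a (Suc k) - a k)\<bar> \<le> (\<Sum>k<n. L * \<bar>x - y\<bar> * (1 / (real k + 2) ^ 3))"
      by (intro order_trans[OF sum_abs] sum_mono step)
    also have "\<dots> \<le> L * \<bar>x - y\<bar> * (1 / 4)"
      unfolding sum_distrib_left[symmetric] using L by (intro mult_left_mono sum_inverse_cube_le) auto
    finally have 2: "\<bar>\<Sum>k<n. q (Suc k) * (a (Suc k) - a k)\<bar> \<le> L * \<bar>x - y\<bar> * (1 / 4)" .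
    have "\<bar>\<Sum>k<n. branch_weight (Suc k) y * (a k - b k)\<bar>
        \<le> (\<Sum>k<n. L * \<bar>x - y\<bar> * (branch_weight (Suc k) y / ((x + real (Suc k)) * (y + real (Suc k)))))"
    proof (intro order_trans[OF sum_abs] sum_mono)
      fix k
      have "\<bar>a k - b k\<bar> \<le> L * \<bar>1 / (x + real (Suc k)) - 1 / (y + real (Suc k))\<bar>"
        unfolding a_def b_def using x0 y0 by (intro lip01D[OF f] inverse_branch_mem)
      also have "\<bar>1 / (x + real (Suc k)) - 1 / (y + real (Suc k))\<bar> = \<bar>x - y\<bar> / ((x + real (Suc k)) * (y + real (Suc k)))"
      proof -
        have "1 / (x + real (Suc k)) - 1 / (y + real (Suc k)) = (y - x) / ((x + real (Suc k)) * (y + real (Suc k)))"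
          using x0 y0 by (simp add: divide_simps)
        then show ?thesis using x0 y0 by (simp add: abs_mult abs_minus_commute)
      qed
      finally have "\<bar>branch_weight (Suc k) y * (a k - b k)\<bar>
          \<le> branch_weight (Suc k) y * (L * (\<bar>x - y\<bar> / ((x + real (Suc k)) * (y + real (Suc k)))))"
        unfolding abs_mult abs_of_nonneg[OF branch_weight_nonneg[OF y0]]
        using branch_weight_nonneg[OF y0] by (intro mult_left_mono)
      then show "\<bar>branch_weight (Suc k) y * (a k - b k)\<bar>
          \<le> L * \<bar>x - y\<bar> * (branch_weight (Suc k) y / ((x + real (Suc k)) * (y + real (Suc k))))"
        by (simp add: mult_ac)
    qed
    also have "\<dots> \<le> L * \<bar>x - y\<bar> * (5 / 8)"
      unfolding sum_distrib_left[symmetric] using L x0 y0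
      by (intro mult_left_mono sum_branch_contraction_le) auto
    finally have 3: "\<bar>\<Sum>k<n. branch_weight (Suc k) y * (a k - b k)\<bar> \<le> L * \<bar>x - y\<bar> * (5 / 8)" .
    show ?thesis unfolding eq using 1 2 3 unfolding abs_le_iff by (simp add: algebra_simps)
  qed
  have "q \<longlonglongrightarrow> 1 - 1" unfolding q_def by (intro tendsto_diff) real_asymp+
  then have "(\<lambda>n. \<bar>q n\<bar> * (f 0 + L) + (7 / 8 * L) * \<bar>x - y\<bar>) \<longlonglongrightarrow> \<bar>1 - 1\<bar> * (f 0 + L) + (7 / 8 * L) * \<bar>x - y\<bar>"
    by (intro tendsto_intros)
  moreover have "(\<lambda>n. \<bar>(\<Sum>k<n. branch_weight (Suc k) x * a k) - (\<Sum>k<n. branch_weight (Suc k) y * b k)\<bar>)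
      \<longlonglongrightarrow> \<bar>transfer_op f x - transfer_op f y\<bar>"
    unfolding a_def b_def transfer_op_def
    by (intro tendsto_intros summable_LIMSEQ summable_transfer_op[OF f] x0 y0)
  ultimately have "\<bar>transfer_op f x - transfer_op f y\<bar> \<le> \<bar>1 - 1\<bar> * (f 0 + L) + (7 / 8 * L) * \<bar>x - y\<bar>"
    by (intro LIMSEQ_le[where X = "\<lambda>n. \<bar>(\<Sum>k<n. branch_weight (Suc k) x * a k) - (\<Sum>k<n. branch_weight (Suc k) y * b k)\<bar>"])
      (use partial in auto)
  then show ?thesis by simp
qed

lemma lip01_transfer_op:
  assumes "lip01 L f" shows "lip01 (7 / 8 * L) (transfer_op f)"
proof -
  have [measurable]: "f \<in> borel_measurable borel" using assms by (simp add: lip01_def)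
  have "transfer_op f \<in> borel_measurable borel" unfolding transfer_op_def by measurable
  moreover have "0 \<le> transfer_op f x" if "x \<in> {0..1}" for x
    unfolding transfer_op_def
    using that by (intro suminf_nonneg summable_transfer_op[OF assms] mult_nonneg_nonneg
        branch_weight_nonneg lip01_nonneg[OF assms] inverse_branch_mem) auto
  ultimately show ?thesis
    unfolding lip01_def using transfer_op_contraction[OF assms] by blast
qed

lemma nn_integral_transfer_op:
  assumes f: "lip01 L f" and [measurable]: "g \<in> borel_measurable borel"
  shows "(\<integral>\<^sup>+x. ennreal (f x) * g (gauss_map x) \<partial>gauss_measure)
       = (\<integral>\<^sup>+x. ennreal (transfer_op f x) * g x \<partial>gauss_measure)"
proof -
  have [measurable]: "f \<in> borel_measurable borel" using f by (simp add: lip01_def)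
  have "(\<integral>\<^sup>+x. ennreal (f x) * g (gauss_map x) \<partial>gauss_measure)
     = (\<integral>\<^sup>+y. (\<Sum>k. ennreal (branch_weight (Suc k) y) * ennreal (f (1 / (y + real (Suc k))))) * g y \<partial>gauss_measure)"
    by (rule nn_integral_gauss_transfer) measurable
  also have "\<dots> = (\<integral>\<^sup>+x. ennreal (transfer_op f x) * g x \<partial>gauss_measure)"
  proof (intro nn_integral_cong_AE, use AE_gauss_lessThan in eventually_elim)
    fix y :: real assume "0 < y \<and> y < 1"
    then have y: "0 \<le> y" by simp
    have nn: "0 \<le> f (1 / (y + real (Suc k)))" for k
      by (rule lip01_nonneg[OF f inverse_branch_mem[OF y]])
    have "(\<Sum>k. ennreal (branch_weight (Suc k) y) * ennreal (f (1 / (y + real (Suc k)))))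
        = (\<Sum>k. ennreal (branch_weight (Suc k) y * f (1 / (y + real (Suc k)))))"
      using nn branch_weight_nonneg[OF y] by (simp add: ennreal_mult)
    also have "\<dots> = ennreal (transfer_op f y)"
      unfolding transfer_op_def
      using nn branch_weight_nonneg[OF y] by (intro suminf_ennreal2 summable_transfer_op[OF f y]) simp
    finally show "(\<Sum>k. ennreal (branch_weight (Suc k) y) * ennreal (f (1 / (y + real (Suc k))))) * g y
      = ennreal (transfer_op f y) * g y" by simp
  qed
  finally show ?thesis .
qed

section \<open>Decay of correlations and quasi-independence of the digits\<close>

lemma nn_integral_transfer_op_funpow:
  assumes "lip01 L f" and [measurable]: "g \<in> borel_measurable borel"
  shows "(\<integral>\<^sup>+x. ennreal (f x) * g ((gauss_map ^^ n) x) \<partial>gauss_measure)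
       = (\<integral>\<^sup>+x. ennreal ((transfer_op ^^ n) f x) * g x \<partial>gauss_measure)"
  using assms(1)
proof (induction n arbitrary: f L)
  case (Suc n)
  have "(\<integral>\<^sup>+x. ennreal (f x) * g ((gauss_map ^^ Suc n) x) \<partial>gauss_measure)
      = (\<integral>\<^sup>+x. ennreal (f x) * g ((gauss_map ^^ n) (gauss_map x)) \<partial>gauss_measure)"
    by (simp add: funpow_swap1)
  also have "\<dots> = (\<integral>\<^sup>+x. ennreal (transfer_op f x) * g ((gauss_map ^^ n) x) \<partial>gauss_measure)"
    by (rule nn_integral_transfer_op[OF Suc.prems]) measurable
  also have "\<dots> = (\<integral>\<^sup>+x. ennreal ((transfer_op ^^ n) (transfer_op f) x) * g x \<partial>gauss_measure)"
    by (rule Suc.IH[OF lip01_transfer_op[OF Suc.prems]])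
  finally show ?case by (simp add: funpow_swap1)
qed simp

lemma lip01_transfer_op_funpow: "lip01 L f \<Longrightarrow> lip01 ((7 / 8) ^ n * L) ((transfer_op ^^ n) f)"
proof (induction n)
  case (Suc n)
  then show ?case using lip01_transfer_op[OF Suc.IH[OF Suc.prems]] by (simp add: mult.assoc)
qed simp

text \<open>Points of the unit interval are at distance at most 1, and the Gauss measure has total
  mass 1. With a small Lipschitz constant, as after many transfer steps, the function is nearly
  bounded by its mean.\<close>

lemma lip01_le_average:
  assumes f: "lip01 L f" and y: "y \<in> {0..1}"
  shows "ennreal (f y) \<le> (\<integral>\<^sup>+x. ennreal (f x) \<partial>gauss_measure) + ennreal L"
proof -
  have L: "0 \<le> L" by (rule lip01_const_nonneg[OF f])
  have "ennreal (f y) = (\<integral>\<^sup>+x. ennreal (f y) \<partial>gauss_measure)"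
    using gauss.emeasure_space_1 by simp
  also have "\<dots> \<le> (\<integral>\<^sup>+x. ennreal (f x) + ennreal L \<partial>gauss_measure)"
  proof (intro nn_integral_mono_AE, use AE_gauss_lessThan in eventually_elim)
    fix x :: real assume x: "0 < x \<and> x < 1"
    then have "\<bar>f y - f x\<bar> \<le> L * \<bar>y - x\<bar>" using y by (intro lip01D[OF f]) auto
    also have "\<dots> \<le> L * 1" using L x y by (intro mult_left_mono) auto
    finally have "f y \<le> f x + L" by simp
    moreover have "0 \<le> f x" using x by (intro lip01_nonneg[OF f]) auto
    ultimately show "ennreal (f y) \<le> ennreal (f x) + ennreal L"
      using L by (simp flip: ennreal_plus)
  qed
  also have "\<dots> = (\<integral>\<^sup>+x. ennreal (f x) \<partial>gauss_measure) + ennreal L"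
    using f gauss.emeasure_space_1 by (subst nn_integral_add) (auto simp: lip01_def)
  finally show ?thesis .
qed

text \<open>Duality moves the n iterates from \<open>g\<close> to \<open>f\<close>. The transferred
  function keeps the mean of \<open>f\<close> and has Lipschitz constant
  \<open>(7 / 8) ^ n * L\<close>, so it is pointwise at most the mean plus that constant.\<close>

lemma nn_integral_mixing_le:
  assumes f: "lip01 L f" and g [measurable]: "g \<in> borel_measurable borel"
  shows "(\<integral>\<^sup>+x. ennreal (f x) * g ((gauss_map ^^ n) x) \<partial>gauss_measure)
       \<le> ((\<integral>\<^sup>+x. ennreal (f x) \<partial>gauss_measure) + ennreal ((7 / 8) ^ n * L)) * (\<integral>\<^sup>+x. g x \<partial>gauss_measure)"
proof -
  let ?h = "(transfer_op ^^ n) f"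
  have h: "lip01 ((7 / 8) ^ n * L) ?h" by (rule lip01_transfer_op_funpow[OF f])
  have eq: "(\<integral>\<^sup>+x. ennreal (?h x) \<partial>gauss_measure) = (\<integral>\<^sup>+x. ennreal (f x) \<partial>gauss_measure)"
    using nn_integral_transfer_op_funpow[OF f, of "\<lambda>_. 1" n] by simp
  have "(\<integral>\<^sup>+x. ennreal (f x) * g ((gauss_map ^^ n) x) \<partial>gauss_measure)
      = (\<integral>\<^sup>+x. ennreal (?h x) * g x \<partial>gauss_measure)"
    by (rule nn_integral_transfer_op_funpow[OF f]) measurable
  also have "\<dots> \<le> (\<integral>\<^sup>+x. ((\<integral>\<^sup>+x. ennreal (f x) \<partial>gauss_measure) + ennreal ((7 / 8) ^ n * L)) * g x \<partial>gauss_measure)"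
  proof (intro nn_integral_mono_AE, use AE_gauss_lessThan in eventually_elim)
    fix x :: real assume "0 < x \<and> x < 1"
    then have "ennreal (?h x) \<le> (\<integral>\<^sup>+x. ennreal (f x) \<partial>gauss_measure) + ennreal ((7 / 8) ^ n * L)"
      using lip01_le_average[OF h, of x] by (simp add: eq)
    then show "ennreal (?h x) * g x \<le> ((\<integral>\<^sup>+x. ennreal (f x) \<partial>gauss_measure) + ennreal ((7 / 8) ^ n * L)) * g x"
      by (rule mult_right_mono) simp
  qed
  also have "\<dots> = ((\<integral>\<^sup>+x. ennreal (f x) \<partial>gauss_measure) + ennreal ((7 / 8) ^ n * L)) * (\<integral>\<^sup>+x. g x \<partial>gauss_measure)"
    by (rule nn_integral_cmult) simp
  finally show ?thesis .
qed

text \<open>The decay of the constant like 1 / k^2, the order of the digit probability itself, is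
  the point: it will make the mixing error relative. The 4 is 1 + 3, from bounding the two terms
  left in the numerator after x - y is factored out.\<close>

lemma lip01_branch_weight:
  assumes k: "0 < k"
  shows "lip01 (4 / (real k * (real k + 1))) (branch_weight k)"
proof -
  define m where "m = real k"
  have m: "1 \<le> m" using k by (simp add: m_def)
  have "\<bar>branch_weight k x - branch_weight k y\<bar> \<le> 4 / (m * (m + 1)) * \<bar>x - y\<bar>"
    if x: "x \<in> {0..1}" and y: "y \<in> {0..1}" for x y
  proof -
    define D where "D = (\<lambda>z. (z + m) * (z + m + 1))"
    have D: "m * (m + 1) \<le> D z" if "z \<in> {0..1}" for z
      using that m unfolding D_def by (intro mult_mono) auto
    have D0: "0 < D z" if "z \<in> {0..1}" for z using D[OF that] m by (smt (verit) mult_pos_pos)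
    have num: "\<bar>(y + 1) * (x + y + 2 * m + 1)\<bar> \<le> 3 * D y"
    proof -
      have "0 \<le> (y + 1) * (x + y + 2 * m + 1)" using x y m by (intro mult_nonneg_nonneg) auto
      moreover have "(y + 1) * (x + y + 2 * m + 1) \<le> (y + m) * (3 * (y + m + 1))"
        using x y m by (intro mult_mono) auto
      moreover have "(y + m) * (3 * (y + m + 1)) = 3 * D y" by (simp add: D_def)
      ultimately show ?thesis by simp
    qed
    have "branch_weight k x - branch_weight k y = (x - y) * ((D y - (y + 1) * (x + y + 2 * m + 1)) / (D x * D y))"
    proof -
      have "(x + 1) * D y - (y + 1) * D x = (x - y) * (D y - (y + 1) * (x + y + 2 * m + 1))"
        unfolding D_def by algebra
      moreover have "branch_weight k x - branch_weight k y = ((x + 1) * D y - (y + 1) * D x) / (D x * D y)"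
        using D0[OF x] D0[OF y] unfolding branch_weight_def D_def m_def by (subst diff_frac_eq) auto
      ultimately show ?thesis by simp
    qed
    also have "\<bar>\<dots>\<bar> = \<bar>x - y\<bar> * (\<bar>D y - (y + 1) * (x + y + 2 * m + 1)\<bar> / (D x * D y))"
      using D0[OF x] D0[OF y] by (simp add: abs_mult)
    also have "\<dots> \<le> \<bar>x - y\<bar> * ((4 * D y) / (D x * D y))"
      using num D0[OF x] D0[OF y] by (intro mult_left_mono divide_right_mono) auto
    also have "\<dots> = \<bar>x - y\<bar> * (4 / D x)" using D0[OF y] by simp
    also have "\<dots> \<le> \<bar>x - y\<bar> * (4 / (m * (m + 1)))"
      using D[OF x] D0[OF x] m by (intro mult_left_mono divide_left_mono mult_pos_pos) auto
    finally show ?thesis by (simp add: mult.commute)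
  qed
  then show ?thesis unfolding lip01_def m_def using branch_weight_nonneg by auto
qed

definition digit_prob :: "nat \<Rightarrow> real" where
  "digit_prob k = measure gauss_measure (branch k)"

lemma nn_integral_branch_weight:
  assumes "0 < k"
  shows "(\<integral>\<^sup>+x. ennreal (branch_weight k x) \<partial>gauss_measure) = ennreal (digit_prob k)"
  using nn_integral_gauss_branch[of "\<lambda>_. 1" k] assms
  by (simp add: digit_prob_def gauss.emeasure_eq_measure)

text \<open>The branch has length 1 / (k (k + 1)), and on it the density lies between its values at
  1 / k and at 0. The resulting bounds differ from each other by O(1 / k^3), close enough for the
  first-order asymptotics of the mean.\<close>

lemma digit_prob_bounds:
  assumes k: "0 < k"
  shows "1 / (ln 2 * (real k + 1)\<^sup>2) \<le> digit_prob k" "digit_prob k \<le> 1 / (ln 2 * (real k)\<^sup>2)"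
proof -
  define m where "m = real k"
  have m: "1 \<le> m" using k by (simp add: m_def)
  have em: "ennreal (digit_prob k) = (\<integral>\<^sup>+x. ennreal (gauss_density x) * indicator (branch k) x \<partial>lborel)"
    unfolding digit_prob_def gauss.emeasure_eq_measure[symmetric] unfolding gauss_measure_def
    by (subst emeasure_density) auto
  have lb: "emeasure lborel (branch k) = ennreal (1 / (m * (m + 1)))"
  proof -
    have "1 / (m + 1) \<le> 1 / m" using m by (intro divide_left_mono) auto
    moreover have "1 / m - 1 / (m + 1) = 1 / (m * (m + 1))" using m by (simp add: divide_simps)
    ultimately show ?thesis unfolding branch_def m_def[symmetric] by simp
  qed
  have const: "(\<integral>\<^sup>+x. ennreal c * indicator (branch k) x \<partial>lborel) = ennreal (c * (1 / (m * (m + 1))))"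
    if "0 \<le> c" for c
    using m that by (subst nn_integral_cmult_indicator) (auto simp: lb simp flip: ennreal_mult)
  have in01: "x \<in> {0..1}" if "x \<in> branch k" for x using branch_subset[OF k] that by auto
  have "ennreal (m / (ln 2 * (m + 1)) * (1 / (m * (m + 1)))) \<le> ennreal (digit_prob k)"
    unfolding em using m
  proof (subst const[symmetric])
    show "(\<integral>\<^sup>+x. ennreal (m / (ln 2 * (m + 1))) * indicator (branch k) x \<partial>lborel)
      \<le> (\<integral>\<^sup>+x. ennreal (gauss_density x) * indicator (branch k) x \<partial>lborel)"
    proof (intro nn_integral_mono)
      fix x
      have "m / (ln 2 * (m + 1)) \<le> gauss_density x" if x: "x \<in> branch k"
      proof -
        have "x \<le> 1 / m" using x by (simp add: branch_def m_def)
        then have "ln 2 * (1 + x) \<le> ln 2 * (1 + 1 / m)" by simp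
        then have "1 / (ln 2 * (1 + 1 / m)) \<le> gauss_density x"
          using in01[OF x] m by (simp add: gauss_density_def frac_le)
        moreover have "1 / (ln 2 * (1 + 1 / m)) = m / (ln 2 * (m + 1))" using m by (simp add: divide_simps)
        ultimately show ?thesis by simp
      qed
      then show "ennreal (m / (ln 2 * (m + 1))) * indicator (branch k) x \<le> ennreal (gauss_density x) * indicator (branch k) x"
        by (auto simp: indicator_def intro: ennreal_leI)
    qed
  qed auto
  then have "m / (ln 2 * (m + 1)) * (1 / (m * (m + 1))) \<le> digit_prob k"
    by (simp add: digit_prob_def)
  moreover have "m / (ln 2 * (m + 1)) * (1 / (m * (m + 1))) = 1 / (ln 2 * (m + 1)\<^sup>2)"
    using m by (simp add: power2_eq_square)
  ultimately show "1 / (ln 2 * (real k + 1)\<^sup>2) \<le> digit_prob k" by (simp add: m_def)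
  have "ennreal (digit_prob k) \<le> ennreal (1 / ln 2 * (1 / (m * (m + 1))))"
    unfolding em
  proof (subst const[symmetric])
    show "(\<integral>\<^sup>+x. ennreal (gauss_density x) * indicator (branch k) x \<partial>lborel)
      \<le> (\<integral>\<^sup>+x. ennreal (1 / ln 2) * indicator (branch k) x \<partial>lborel)"
    proof (intro nn_integral_mono)
      fix x :: real
      have "gauss_density x \<le> 1 / ln 2" if "x \<in> branch k"
        using in01[OF that] by (simp add: gauss_density_def frac_le)
      then show "ennreal (gauss_density x) * indicator (branch k) x \<le> ennreal (1 / ln 2) * indicator (branch k) x"
        by (auto simp: indicator_def intro: ennreal_leI)
    qed
  qed auto
  then have "digit_prob k \<le> 1 / ln 2 * (1 / (m * (m + 1)))" using m by simp
  also have "\<dots> \<le> 1 / ln 2 * (1 / (m * m))"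
    using m by (intro mult_left_mono divide_left_mono mult_pos_pos) auto
  finally show "digit_prob k \<le> 1 / (ln 2 * (real k)\<^sup>2)" by (simp add: m_def power2_eq_square)
qed

text \<open>The indicator of a branch is not Lipschitz, but one transfer step turns it into
  \<open>branch_weight k\<close>; this step accounts for \<open>Suc n\<close> on the left against
  the exponent \<open>n\<close> on the right. The 8 compares 4 / (k (k + 1)) with the lower bound
  for \<open>digit_prob k\<close>, using k + 1 \<le> 2 k.\<close>

lemma measure_branch_inter_le:
  assumes k: "0 < k" and B [measurable]: "B \<in> sets borel"
  shows "measure gauss_measure {x. x \<in> branch k \<and> (gauss_map ^^ Suc n) x \<in> B}
    \<le> digit_prob k * measure gauss_measure B * (1 + 8 * (7 / 8) ^ n)"
proof -
  let ?\<mu> = "digit_prob k" and ?L = "4 / (real k * (real k + 1))"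
  have \<mu>: "0 \<le> ?\<mu>" by (simp add: digit_prob_def)
  have [measurable]: "{x. x \<in> branch k \<and> (gauss_map ^^ Suc n) x \<in> B} \<in> sets borel" by measurable
  have "?L \<le> 8 / (real k + 1)\<^sup>2"
    using k by (simp add: divide_simps power2_eq_square)
  also have "\<dots> \<le> 8 / (ln 2 * (real k + 1)\<^sup>2)"
    using ln_le_minus_one[of "2::real"] by (intro divide_left_mono) (auto simp: mult_le_cancel_right1)
  also have "\<dots> = 8 * (1 / (ln 2 * (real k + 1)\<^sup>2))" by simp
  also have "\<dots> \<le> 8 * ?\<mu>" using digit_prob_bounds(1)[OF k] by (intro mult_left_mono) auto
  finally have L: "?L \<le> 8 * ?\<mu>" .
  have "emeasure gauss_measure {x. x \<in> branch k \<and> (gauss_map ^^ Suc n) x \<in> B}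
      = (\<integral>\<^sup>+x. indicator {x. x \<in> branch k \<and> (gauss_map ^^ Suc n) x \<in> B} x \<partial>gauss_measure)"
    by simp
  also have "\<dots> = (\<integral>\<^sup>+x. 1 * indicator B ((gauss_map ^^ n) (gauss_map x)) * indicator (branch k) x \<partial>gauss_measure)"
    by (intro nn_integral_cong) (auto simp: indicator_def funpow_swap1)
  also have "\<dots> = (\<integral>\<^sup>+y. ennreal (branch_weight k y) * 1 * indicator B ((gauss_map ^^ n) y) \<partial>gauss_measure)"
    by (rule nn_integral_gauss_branch_map[OF _ _ k]) measurable
  also have "\<dots> \<le> (ennreal ?\<mu> + ennreal ((7 / 8) ^ n * ?L)) * (\<integral>\<^sup>+x. indicator B x \<partial>gauss_measure)"
    using nn_integral_mixing_le[OF lip01_branch_weight[OF k], of "indicator B" n]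
    by (simp add: nn_integral_branch_weight[OF k])
  also have "\<dots> = ennreal ((?\<mu> + (7 / 8) ^ n * ?L) * measure gauss_measure B)"
    using \<mu> k by (simp add: gauss.emeasure_eq_measure ennreal_mult flip: ennreal_plus)
  finally have "measure gauss_measure {x. x \<in> branch k \<and> (gauss_map ^^ Suc n) x \<in> B}
      \<le> (?\<mu> + (7 / 8) ^ n * ?L) * measure gauss_measure B"
    using \<mu> k by (simp add: gauss.emeasure_eq_measure)
  also have "\<dots> \<le> (?\<mu> + (7 / 8) ^ n * (8 * ?\<mu>)) * measure gauss_measure B"
    by (intro mult_right_mono add_left_mono mult_left_mono L) auto
  finally show ?thesis by (simp add: algebra_simps)
qed

section \<open>Truncated sums of prime digits\<close>

lemma distr_gauss_funpow: "distr gauss_measure borel (gauss_map ^^ n) = gauss_measure"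
proof (rule measure_eqI)
  fix A assume "A \<in> sets (distr gauss_measure borel (gauss_map ^^ n))"
  then have [measurable]: "A \<in> sets borel" by simp
  have "(gauss_map ^^ n) -` A = {x. (gauss_map ^^ n) x \<in> A}" by auto
  then show "emeasure (distr gauss_measure borel (gauss_map ^^ n)) A = emeasure gauss_measure A"
    by (subst emeasure_distr) (simp_all add: gauss.emeasure_eq_measure measure_gauss_map_funpow)
qed simp

lemma integral_gauss_map_funpow:
  fixes h :: "real \<Rightarrow> real"
  assumes [measurable]: "h \<in> borel_measurable borel"
  shows "(\<integral>x. h ((gauss_map ^^ n) x) \<partial>gauss_measure) = (\<integral>x. h x \<partial>gauss_measure)"
  by (subst (2) distr_gauss_funpow[symmetric, of n], subst integral_distr) auto

text \<open>A finite combination of indicators, so that means and correlations become finite sums of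
  measures of branches and of their intersections.\<close>

definition trunc_digit :: "nat \<Rightarrow> real \<Rightarrow> real" where
  "trunc_digit M x = (\<Sum>p\<in>primes_upto M. real p * indicator (branch p) x)"

definition trunc_mean :: "nat \<Rightarrow> real" where
  "trunc_mean M = (\<Sum>p\<in>primes_upto M. real p * digit_prob p)"

definition trunc_sum :: "nat \<Rightarrow> nat \<Rightarrow> real \<Rightarrow> real" where
  "trunc_sum M n x = (\<Sum>k<n. trunc_digit M ((gauss_map ^^ k) x))"

lemma trunc_digit_measurable [measurable]: "trunc_digit M \<in> borel_measurable borel"
  unfolding trunc_digit_def by measurable

lemma trunc_sum_measurable [measurable]: "trunc_sum M n \<in> borel_measurable borel"
  unfolding trunc_sum_def by measurable

lemma trunc_digit_nonneg: "0 \<le> trunc_digit M x"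
  unfolding trunc_digit_def by (intro sum_nonneg) auto

lemma trunc_digit_le: "trunc_digit M x \<le> (\<Sum>p\<in>primes_upto M. real p)"
  unfolding trunc_digit_def by (intro sum_mono) (simp add: indicator_def)

lemma primes_upto_pos: "p \<in> primes_upto M \<Longrightarrow> 0 < p"
  by (auto dest: primes_uptoD)

lemma trunc_digit_eq:
  "trunc_digit M x = (if nat \<lfloor>1 / x\<rfloor> \<in> primes_upto M then real (nat \<lfloor>1 / x\<rfloor>) else 0)"
proof -
  have "trunc_digit M x = (\<Sum>p\<in>primes_upto M. if nat \<lfloor>1 / x\<rfloor> = p then real p else 0)"
    unfolding trunc_digit_def by (intro sum.cong) (auto simp: branch_iff primes_upto_pos)
  then show ?thesis by (simp add: sum.delta)
qed

lemma integrable_bounded_gauss: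
  fixes h :: "real \<Rightarrow> real"
  assumes "h \<in> borel_measurable borel" "\<And>x. \<bar>h x\<bar> \<le> B"
  shows "integrable gauss_measure h"
  using assms by (intro gauss.integrable_const_bound[of _ B]) auto

lemma integrable_trunc_digit: "integrable gauss_measure (\<lambda>x. trunc_digit M ((gauss_map ^^ i) x))"
  using trunc_digit_nonneg trunc_digit_le by (intro integrable_bounded_gauss) auto

lemma integrable_trunc_digit_mult:
  "integrable gauss_measure (\<lambda>x. trunc_digit M ((gauss_map ^^ i) x) * trunc_digit M ((gauss_map ^^ j) x))"
proof (rule integrable_bounded_gauss)
  show "\<bar>trunc_digit M ((gauss_map ^^ i) x) * trunc_digit M ((gauss_map ^^ j) x)\<bar>
     \<le> (\<Sum>p\<in>primes_upto M. real p) * (\<Sum>p\<in>primes_upto M. real p)" for x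
    unfolding abs_mult abs_of_nonneg[OF trunc_digit_nonneg]
    by (intro mult_mono trunc_digit_le trunc_digit_nonneg sum_nonneg) auto
qed measurable

lemma integral_sum_indicator_gauss:
  fixes c :: "'i \<Rightarrow> real"
  assumes "\<And>i. i \<in> I \<Longrightarrow> A i \<in> sets borel"
  shows "(\<integral>x. (\<Sum>i\<in>I. c i * indicator (A i) x) \<partial>gauss_measure) = (\<Sum>i\<in>I. c i * measure gauss_measure (A i))"
proof -
  have "(\<integral>x. (\<Sum>i\<in>I. c i * indicator (A i) x) \<partial>gauss_measure)
      = (\<Sum>i\<in>I. \<integral>x. c i * indicator (A i) x \<partial>gauss_measure)"
    using assms by (intro Bochner_Integration.integral_sum) (auto simp: gauss.emeasure_eq_measure)
  then show ?thesis by simp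
qed

lemma integral_trunc_digit:
  "(\<integral>x. trunc_digit M ((gauss_map ^^ i) x) \<partial>gauss_measure) = trunc_mean M"
proof -
  have "(\<integral>x. trunc_digit M ((gauss_map ^^ i) x) \<partial>gauss_measure) = (\<integral>x. trunc_digit M x \<partial>gauss_measure)"
    by (rule integral_gauss_map_funpow) measurable
  also have "\<dots> = trunc_mean M"
    unfolding trunc_digit_def trunc_mean_def digit_prob_def
    by (rule integral_sum_indicator_gauss) simp
  finally show ?thesis .
qed

section \<open>Correlations and second moment of the truncated sums\<close>

definition trunc_corr :: "nat \<Rightarrow> nat \<Rightarrow> real" where
  "trunc_corr M n = (\<integral>x. trunc_digit M x * trunc_digit M ((gauss_map ^^ n) x) \<partial>gauss_measure)"

lemma integral_trunc_digit_mult: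
  "(\<integral>x. trunc_digit M ((gauss_map ^^ i) x) * trunc_digit M ((gauss_map ^^ (n + i)) x) \<partial>gauss_measure) = trunc_corr M n"
  using integral_gauss_map_funpow[of "\<lambda>x. trunc_digit M x * trunc_digit M ((gauss_map ^^ n) x)" i]
  by (simp add: trunc_corr_def funpow_add)

text \<open>Branches are disjoint, so only the diagonal survives in the square. There p^2 cancels
  the decay of the digit probability and each prime contributes at most 1 / ln 2, which is why a
  count of primes appears.\<close>

lemma trunc_corr_0: "trunc_corr M 0 \<le> real (card (primes_upto M)) / ln 2"
proof -
  have "trunc_digit M x * trunc_digit M x = (\<Sum>p\<in>primes_upto M. (real p)\<^sup>2 * indicator (branch p) x)" for x
  proof -
    have "(\<Sum>p\<in>primes_upto M. (real p)\<^sup>2 * indicator (branch p) x)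
        = (\<Sum>p\<in>primes_upto M. if nat \<lfloor>1 / x\<rfloor> = p then (real p)\<^sup>2 else 0)"
      by (intro sum.cong) (auto simp: branch_iff primes_upto_pos)
    then show ?thesis by (simp add: sum.delta trunc_digit_eq power2_eq_square)
  qed
  then have "trunc_corr M 0 = (\<integral>x. (\<Sum>p\<in>primes_upto M. (real p)\<^sup>2 * indicator (branch p) x) \<partial>gauss_measure)"
    by (simp add: trunc_corr_def)
  also have "\<dots> = (\<Sum>p\<in>primes_upto M. (real p)\<^sup>2 * digit_prob p)"
    unfolding digit_prob_def by (rule integral_sum_indicator_gauss) simp
  also have "\<dots> \<le> (\<Sum>p\<in>primes_upto M. 1 / ln 2)"
  proof (intro sum_mono)
    fix p assume "p \<in> primes_upto M"
    then have p: "0 < p" by (rule primes_upto_pos)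
    then have "(real p)\<^sup>2 * digit_prob p \<le> (real p)\<^sup>2 * (1 / (ln 2 * (real p)\<^sup>2))"
      by (intro mult_left_mono digit_prob_bounds) auto
    then show "(real p)\<^sup>2 * digit_prob p \<le> 1 / ln 2" using p by simp
  qed
  finally show ?thesis by simp
qed

text \<open>Because the mixing error is a common factor of the products of probabilities, the double
  sum over primes factors into the square of the mean.\<close>

lemma trunc_corr_Suc: "trunc_corr M (Suc n) \<le> (trunc_mean M)\<^sup>2 * (1 + 8 * (7 / 8) ^ n)"
proof -
  let ?A = "\<lambda>p q. {x. x \<in> branch p \<and> (gauss_map ^^ Suc n) x \<in> branch q}"
  have [measurable]: "?A p q \<in> sets borel" for p q by measurable
  let ?P = "primes_upto M \<times> primes_upto M"
  have "trunc_digit M x * trunc_digit M ((gauss_map ^^ Suc n) x)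
     = (\<Sum>z\<in>?P. real (fst z) * real (snd z) * indicator (?A (fst z) (snd z)) x)" for x
    unfolding trunc_digit_def sum_product sum.cartesian_product
    by (intro sum.cong refl) (auto simp: indicator_def)
  then have "trunc_corr M (Suc n)
     = (\<integral>x. (\<Sum>z\<in>?P. real (fst z) * real (snd z) * indicator (?A (fst z) (snd z)) x) \<partial>gauss_measure)"
    unfolding trunc_corr_def by presburger
  also have "\<dots> = (\<Sum>z\<in>?P. real (fst z) * real (snd z) * measure gauss_measure (?A (fst z) (snd z)))"
    by (rule integral_sum_indicator_gauss) measurable
  also have "\<dots> = (\<Sum>p\<in>primes_upto M. \<Sum>q\<in>primes_upto M. real p * real q * measure gauss_measure (?A p q))"
    by (simp add: sum.cartesian_product case_prod_beta)
  also have "\<dots> \<le> (\<Sum>p\<in>primes_upto M. \<Sum>q\<in>primes_upto M.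
      real p * real q * (digit_prob p * digit_prob q * (1 + 8 * (7 / 8) ^ n)))"
    using measure_branch_inter_le[of _ "branch q" n for q]
    by (intro sum_mono mult_left_mono) (auto simp: digit_prob_def[symmetric] primes_upto_pos)
  also have "\<dots> = (\<Sum>p\<in>primes_upto M. \<Sum>q\<in>primes_upto M.
      (real p * digit_prob p) * (real q * digit_prob q)) * (1 + 8 * (7 / 8) ^ n)"
    unfolding sum_distrib_right by (intro sum.cong refl) (simp only: mult_ac)
  finally show ?thesis by (simp only: power2_eq_square trunc_mean_def sum_product)
qed

lemma sum_trunc_corr_le: "(\<Sum>k<n. trunc_corr M (Suc k)) \<le> real n * (trunc_mean M)\<^sup>2 + 64 * (trunc_mean M)\<^sup>2"
proof -
  have "(\<Sum>k<n. trunc_corr M (Suc k)) \<le> (\<Sum>k<n. (trunc_mean M)\<^sup>2 * (1 + 8 * (7 / 8) ^ k))"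
    by (intro sum_mono trunc_corr_Suc)
  also have "\<dots> = (trunc_mean M)\<^sup>2 * (real n + 8 * (\<Sum>k<n. (7 / 8) ^ k))"
    by (simp add: sum_distrib_left[symmetric] sum.distrib)
  also have "\<dots> \<le> (trunc_mean M)\<^sup>2 * (real n + 8 * 8)"
  proof -
    have "(\<Sum>k<n. (7 / 8) ^ k) = 8 * (1 - (7 / 8 :: real) ^ n)"
      by (subst sum_gp_strict) simp
    also have "\<dots> \<le> 8" by simp
    finally have "(\<Sum>k<n. (7 / 8 :: real) ^ k) \<le> 8" .
    then show ?thesis by (intro mult_left_mono) auto
  qed
  finally show ?thesis by (simp add: algebra_simps)
qed

lemma integrable_trunc_sum: "integrable gauss_measure (trunc_sum M n)"
  unfolding trunc_sum_def by (intro Bochner_Integration.integrable_sum integrable_trunc_digit)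

lemma integrable_trunc_sum_square: "integrable gauss_measure (\<lambda>x. (trunc_sum M n x)\<^sup>2)"
  unfolding trunc_sum_def power2_eq_square sum_product
  by (intro Bochner_Integration.integrable_sum integrable_trunc_digit_mult)

lemma integral_trunc_sum: "(\<integral>x. trunc_sum M n x \<partial>gauss_measure) = real n * trunc_mean M"
  unfolding trunc_sum_def
  by (subst Bochner_Integration.integral_sum) (auto simp: integrable_trunc_digit integral_trunc_digit)

text \<open>Adding one digit contributes twice the cross terms, at most 2 n + 128 squared means, and
  one diagonal term. The 2 n fits into the growth from n^2 to (n + 1)^2, and the 128 is twice the 64
  obtained from the geometric series of mixing errors.\<close>

lemma second_moment_trunc_sum:
  "(\<integral>x. (trunc_sum M n x)\<^sup>2 \<partial>gauss_measure)
    \<le> (real n * trunc_mean M)\<^sup>2 + real n * (128 * (trunc_mean M)\<^sup>2 + trunc_corr M 0)"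
proof (induction n)
  case (Suc n)
  let ?X = "\<lambda>i x. trunc_digit M ((gauss_map ^^ i) x)"
  have cross: "integrable gauss_measure (\<lambda>x. trunc_sum M n x * ?X n x)"
    unfolding trunc_sum_def sum_distrib_right by (intro Bochner_Integration.integrable_sum integrable_trunc_digit_mult)
  have "(\<integral>x. trunc_sum M n x * ?X n x \<partial>gauss_measure) = (\<Sum>i<n. \<integral>x. ?X i x * ?X n x \<partial>gauss_measure)"
    unfolding trunc_sum_def sum_distrib_right
    by (rule Bochner_Integration.integral_sum) (rule integrable_trunc_digit_mult)
  also have "\<dots> = (\<Sum>i<n. trunc_corr M (n - i))"
  proof (intro sum.cong refl)
    fix i assume "i \<in> {..<n}"
    then show "(\<integral>x. ?X i x * ?X n x \<partial>gauss_measure) = trunc_corr M (n - i)"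
      using integral_trunc_digit_mult[of M i "n - i"] by simp
  qed
  also have "\<dots> = (\<Sum>i<n. trunc_corr M (Suc (n - Suc i)))" by (intro sum.cong refl) (simp add: Suc_diff_Suc)
  also have "\<dots> = (\<Sum>k<n. trunc_corr M (Suc k))" by (rule sum.nat_diff_reindex)
  also have "\<dots> \<le> real n * (trunc_mean M)\<^sup>2 + 64 * (trunc_mean M)\<^sup>2" by (rule sum_trunc_corr_le)
  finally have C: "(\<integral>x. trunc_sum M n x * ?X n x \<partial>gauss_measure) \<le> real n * (trunc_mean M)\<^sup>2 + 64 * (trunc_mean M)\<^sup>2" .
  have "(\<integral>x. (trunc_sum M (Suc n) x)\<^sup>2 \<partial>gauss_measure)
      = (\<integral>x. (trunc_sum M n x)\<^sup>2 + (2 * (trunc_sum M n x * ?X n x) + ?X n x * ?X n x) \<partial>gauss_measure)"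
    by (simp add: trunc_sum_def power2_eq_square algebra_simps)
  also have "\<dots> = (\<integral>x. (trunc_sum M n x)\<^sup>2 \<partial>gauss_measure)
      + (2 * (\<integral>x. trunc_sum M n x * ?X n x \<partial>gauss_measure) + trunc_corr M 0)"
    using integral_trunc_digit_mult[of M n 0]
    by (simp add: integrable_trunc_sum_square cross integrable_trunc_digit_mult)
  also have "\<dots> \<le> (real n * trunc_mean M)\<^sup>2 + real n * (128 * (trunc_mean M)\<^sup>2 + trunc_corr M 0)
      + (2 * (real n * (trunc_mean M)\<^sup>2 + 64 * (trunc_mean M)\<^sup>2) + trunc_corr M 0)"
    using Suc C by (intro add_mono mult_left_mono) auto
  also have "\<dots> \<le> (real (Suc n) * trunc_mean M)\<^sup>2 + real (Suc n) * (128 * (trunc_mean M)\<^sup>2 + trunc_corr M 0)"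
    by (simp add: power2_eq_square algebra_simps)
  finally show ?case .
qed (simp add: trunc_sum_def)

lemma prob_trunc_sum_deviation:
  assumes e: "0 < e" and n: "0 < n" and m: "0 < trunc_mean M"
  shows "measure gauss_measure {x. e * (real n * trunc_mean M) \<le> \<bar>trunc_sum M n x - real n * trunc_mean M\<bar>}
    \<le> (128 * (trunc_mean M)\<^sup>2 + trunc_corr M 0) / (e\<^sup>2 * real n * (trunc_mean M)\<^sup>2)"
proof -
  define a where "a = e * (real n * trunc_mean M)"
  have a: "0 < a" using assms by (simp add: a_def)
  have "measure gauss_measure {x. a \<le> \<bar>trunc_sum M n x - real n * trunc_mean M\<bar>}
      \<le> gauss.variance (trunc_sum M n) / a\<^sup>2"
    using gauss.Chebyshev_inequality[of "trunc_sum M n" a] a integrable_trunc_sum_square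
    by (simp add: integral_trunc_sum)
  also have "gauss.variance (trunc_sum M n)
      = (\<integral>x. (trunc_sum M n x)\<^sup>2 \<partial>gauss_measure) - (real n * trunc_mean M)\<^sup>2"
    by (subst gauss.variance_eq) (auto simp: integral_trunc_sum integrable_trunc_sum integrable_trunc_sum_square)
  also have "\<dots> / a\<^sup>2 \<le> (real n * (128 * (trunc_mean M)\<^sup>2 + trunc_corr M 0)) / a\<^sup>2"
    using second_moment_trunc_sum[of M n] by (intro divide_right_mono) auto
  also have "\<dots> = (128 * (trunc_mean M)\<^sup>2 + trunc_corr M 0) / (e\<^sup>2 * real n * (trunc_mean M)\<^sup>2)"
    using n by (simp add: a_def power2_eq_square)
  finally show ?thesis by (simp add: a_def)
qed

section \<open>Large prime digits and the exceptional sets\<close>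

definition large_prime_digit :: "nat \<Rightarrow> real set" where
  "large_prime_digit N = (\<Union>m. \<Union>p\<in>primes_upto m - primes_upto N. branch p)"

lemma large_prime_digit_measurable [measurable]: "large_prime_digit N \<in> sets borel"
  unfolding large_prime_digit_def by (intro sets.countable_UN sets.finite_UN) auto

lemma measure_large_prime_digit:
  assumes N: "2 \<le> N"
  shows "measure gauss_measure (large_prime_digit N) \<le> 12 / (ln 2 * (real N * ln (real N)))"
proof -
  let ?A = "\<lambda>m. \<Union>p\<in>primes_upto m - primes_upto N. branch p"
  \<comment> \<open>The finite unions increase with m, so continuity from below reduces the measure
    to finite tail sums, which are bounded uniformly in m.\<close>
  have "(\<lambda>m. measure gauss_measure (?A m)) \<longlonglongrightarrow> measure gauss_measure (\<Union>m. ?A m)"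
    by (rule gauss.finite_Lim_measure_incseq) (auto simp: incseq_def primes_upto_def)
  moreover have "measure gauss_measure (?A m) \<le> 12 / (ln 2 * (real N * ln (real N)))" for m
  proof -
    have "measure gauss_measure (?A m) \<le> (\<Sum>p\<in>primes_upto m - primes_upto N. measure gauss_measure (branch p))"
      by (rule gauss.finite_measure_subadditive_finite) auto
    also have "\<dots> \<le> (\<Sum>p\<in>primes_upto m - primes_upto N. 1 / ln 2 * (1 / (real p)\<^sup>2))"
      using digit_prob_bounds(2) by (intro sum_mono) (auto simp: digit_prob_def[symmetric] primes_upto_pos)
    also have "\<dots> \<le> 1 / ln 2 * (12 / (real N * ln (real N)))"
      unfolding sum_distrib_left[symmetric] by (intro mult_left_mono sum_prime_squares_tail_le N) auto
    finally show ?thesis by simp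
  qed
  ultimately show ?thesis unfolding large_prime_digit_def by (intro LIMSEQ_le_const2) auto
qed

lemma prime_digit_eq_trunc_digit:
  assumes "(gauss_map ^^ k) x \<notin> large_prime_digit N"
  shows "real (prime_digit (Suc k) x) = trunc_digit N ((gauss_map ^^ k) x)"
proof -
  define a where "a = nat \<lfloor>1 / (gauss_map ^^ k) x\<rfloor>"
  have "a \<le> N" if "prime a"
  proof (rule ccontr)
    assume "\<not> a \<le> N"
    with that have "a \<in> primes_upto a - primes_upto N" by (simp add: primes_upto_def)
    moreover have "(gauss_map ^^ k) x \<in> branch a"
      using branch_iff[OF prime_gt_0_nat[OF that], of "(gauss_map ^^ k) x"] a_def by simp
    ultimately show False using assms unfolding large_prime_digit_def by blast
  qed
  then show ?thesis
    by (auto simp: prime_digit_def cf_digit_def trunc_digit_eq a_def[symmetric] primes_upto_def)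
qed

definition bad_set :: "real \<Rightarrow> nat \<Rightarrow> real set" where
  "bad_set e N = {x. e * (real N * trunc_mean N) \<le> \<bar>trunc_sum N N x - real N * trunc_mean N\<bar>}
     \<union> (\<Union>k<N. {x. (gauss_map ^^ k) x \<in> large_prime_digit N})"

lemma bad_set_measurable [measurable]: "bad_set e N \<in> sets borel"
  unfolding bad_set_def by measurable

lemma not_bad_setD:
  assumes "x \<notin> bad_set e N"
  shows "\<bar>(\<Sum>k=1..N. real (prime_digit k x)) - real N * trunc_mean N\<bar> < e * (real N * trunc_mean N)"
proof -
  have "(\<Sum>k=1..N. real (prime_digit k x)) = (\<Sum>k<N. real (prime_digit (Suc k) x))"
    by (simp add: sum.atLeast1_atMost_eq)
  also have "\<dots> = trunc_sum N N x"
    unfolding trunc_sum_def using assms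
    by (intro sum.cong refl prime_digit_eq_trunc_digit) (auto simp: bad_set_def)
  finally show ?thesis using assms by (auto simp: bad_set_def)
qed

lemma trunc_mean_pos:
  assumes "2 \<le> N" shows "0 < trunc_mean 2" "trunc_mean 2 \<le> trunc_mean N"
proof -
  have "(2::nat) \<in> primes_upto 2" by (simp add: primes_upto_def)
  moreover have pos: "0 < digit_prob p" if "0 < p" for p
    using digit_prob_bounds(1)[OF that] by (rule less_le_trans[rotated]) simp
  ultimately show "0 < trunc_mean 2" unfolding trunc_mean_def
    by (intro sum_pos) (auto simp: primes_upto_pos)
  show "trunc_mean 2 \<le> trunc_mean N"
    unfolding trunc_mean_def using assms
    by (intro sum_mono2) (auto simp: primes_upto_def digit_prob_def)
qed

text \<open>Relative to the squared mean of the sum, the diagonal terms are of order pi(N) / N, and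
  the mixing terms of order 1 / N; the mean is bounded below by the constant
  \<open>trunc_mean 2\<close>. By invariance the large digits cost N times a tail of order 1 / (N ln
  N).\<close>

lemma measure_bad_set:
  assumes e: "0 < e"
  obtains K where "\<And>N. 2 \<le> N \<Longrightarrow> measure gauss_measure (bad_set e N) \<le> K / ln (real N)"
proof
  fix N :: nat assume N: "2 \<le> N"
  let ?m = "trunc_mean N" and ?c = "trunc_mean 2"
  have c: "0 < ?c" "?c \<le> ?m" using trunc_mean_pos[OF N] by auto
  have ln: "0 < ln (real N)" "ln (real N) \<le> real N" using N ln_le_minus_one[of "real N"] by auto
  have "measure gauss_measure {x. e * (real N * ?m) \<le> \<bar>trunc_sum N N x - real N * ?m\<bar>}
      \<le> (128 * ?m\<^sup>2 + trunc_corr N 0) / (e\<^sup>2 * real N * ?m\<^sup>2)"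
    using e N c by (intro prob_trunc_sum_deviation) auto
  also have "\<dots> = 128 / (e\<^sup>2 * real N) + trunc_corr N 0 / (e\<^sup>2 * real N * ?m\<^sup>2)"
    using c by (simp add: add_divide_distrib)
  also have "128 / (e\<^sup>2 * real N) \<le> 128 / (e\<^sup>2 * ln (real N))"
    using e ln N by (intro divide_left_mono mult_left_mono mult_pos_pos) auto
  also have "trunc_corr N 0 / (e\<^sup>2 * real N * ?m\<^sup>2) \<le> (10 * real N / ln (real N) / ln 2) / (e\<^sup>2 * real N * ?c\<^sup>2)"
  proof (intro frac_le mult_left_mono power_mono)
    have "real (card (primes_upto N)) / ln 2 \<le> 10 * real N / ln (real N) / ln 2"
      by (intro divide_right_mono card_primes_upto_le N) auto
    with trunc_corr_0[of N] show "trunc_corr N 0 \<le> 10 * real N / ln (real N) / ln 2" by linarith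
  qed (use e N c ln in auto)
  also have "\<dots> = 10 / (ln 2 * e\<^sup>2 * ?c\<^sup>2) / ln (real N)"
    using N by (simp add: mult_ac)
  finally have 1: "measure gauss_measure {x. e * (real N * ?m) \<le> \<bar>trunc_sum N N x - real N * ?m\<bar>}
      \<le> 128 / e\<^sup>2 / ln (real N) + 10 / (ln 2 * e\<^sup>2 * ?c\<^sup>2) / ln (real N)" by simp
  have "measure gauss_measure (\<Union>k<N. {x. (gauss_map ^^ k) x \<in> large_prime_digit N})
      \<le> (\<Sum>k<N. measure gauss_measure {x. (gauss_map ^^ k) x \<in> large_prime_digit N})"
    by (rule gauss.finite_measure_subadditive_finite) auto
  also have "\<dots> = real N * measure gauss_measure (large_prime_digit N)"
    by (simp add: measure_gauss_map_funpow)
  also have "\<dots> \<le> real N * (12 / (ln 2 * (real N * ln (real N))))"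
    by (intro mult_left_mono measure_large_prime_digit N) auto
  also have "\<dots> = 12 / ln 2 / ln (real N)" using N by simp
  finally have 2: "measure gauss_measure (\<Union>k<N. {x. (gauss_map ^^ k) x \<in> large_prime_digit N}) \<le> 12 / ln 2 / ln (real N)" .
  have "measure gauss_measure (bad_set e N)
     \<le> measure gauss_measure {x. e * (real N * ?m) \<le> \<bar>trunc_sum N N x - real N * ?m\<bar>}
       + measure gauss_measure (\<Union>k<N. {x. (gauss_map ^^ k) x \<in> large_prime_digit N})"
    unfolding bad_set_def by (rule measure_Un_le) auto
  with 1 2 show "measure gauss_measure (bad_set e N)
      \<le> (128 / e\<^sup>2 + 10 / (ln 2 * e\<^sup>2 * ?c\<^sup>2) + 12 / ln 2) / ln (real N)"
    by (simp add: add_divide_distrib)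
qed

section \<open>Convergence along the blocks\<close>

lemma nbar_mono: "i \<le> j \<Longrightarrow> nbar i \<le> nbar j"
proof (cases "i = 0")
  case False
  assume ij: "i \<le> j"
  have "real i * (ln (real i))\<^sup>2 \<le> real j * (ln (real j))\<^sup>2"
    using ij False by (intro mult_mono power_mono) auto
  then show ?thesis using ij False by (simp add: nbar_def)
qed (simp add: nbar_def)

lemma eventually_nbar_eq: "\<forall>\<^sub>F j in sequentially. nbar j = exp (real j * (ln (real j))\<^sup>2)"
  using eventually_gt_at_top[of 0] by eventually_elim (simp add: nbar_def)

lemma nbar_at_top: "filterlim nbar at_top sequentially"
proof (subst filterlim_cong[OF refl refl eventually_nbar_eq])
  show "filterlim (\<lambda>j. exp (real j * (ln (real j))\<^sup>2)) at_top sequentially" by real_asymp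
qed

definition nbar_floor :: "nat \<Rightarrow> nat" where
  "nbar_floor j = nat \<lfloor>nbar j\<rfloor>"

lemma nbar_floor_at_top: "filterlim nbar_floor at_top sequentially"
proof -
  have "filterlim (\<lambda>x::real. nat \<lfloor>x\<rfloor>) at_top at_top"
    by (intro filterlim_compose[OF filterlim_nat_sequentially filterlim_floor_sequentially])
  then show ?thesis unfolding nbar_floor_def using nbar_at_top by (rule filterlim_compose)
qed

text \<open>The shift in the logarithm keeps the terms decreasing from \<open>j = 1\<close> on, where \<open>ln 1 = 0\<close> would
  produce a division by zero.\<close>
lemma summable_bertrand: "summable (\<lambda>j. 1 / (real j * (ln (real j + 1))\<^sup>2))"
proof (subst condensation_test)
  fix m :: nat assume m: "0 < m"
  then show "1 / (real (Suc m) * (ln (real (Suc m) + 1))\<^sup>2) \<le> 1 / (real m * (ln (real m + 1))\<^sup>2)"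
    by (intro divide_left_mono mult_mono power_mono mult_pos_pos) auto
next
  show "summable (\<lambda>n. 2 ^ n * (1 / (real (2 ^ n) * (ln (real (2 ^ n) + 1))\<^sup>2)))"
  proof (rule summable_comparison_test_ev)
    show "summable (\<lambda>n. 1 / (ln 2)\<^sup>2 * (1 / (real n)\<^sup>2))"
      by (intro summable_mult) (use inverse_power_summable[of 2, where ?'a = real] in \<open>simp add: inverse_eq_divide\<close>)
    show "\<forall>\<^sub>F n in sequentially. norm (2 ^ n * (1 / (real (2 ^ n) * (ln (real (2 ^ n) + 1))\<^sup>2)))
        \<le> 1 / (ln 2)\<^sup>2 * (1 / (real n)\<^sup>2)"
      using eventually_gt_at_top[of 0]
    proof eventually_elim
      case (elim n)
      have pos: "0 < real n * ln 2" using elim by simp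
      have "real n * ln 2 = ln (2 ^ n)" by (simp add: ln_realpow)
      also have "\<dots> \<le> ln (2 ^ n + 1)" by (subst ln_le_cancel_iff) (auto intro: add_pos_pos)
      finally have le: "real n * ln 2 \<le> ln (2 ^ n + 1)" .
      then have "1 / (ln (2 ^ n + 1))\<^sup>2 \<le> 1 / (real n * ln 2)\<^sup>2"
        using pos by (intro frac_le power_mono zero_less_power) auto
      then show ?case by (simp add: power_mult_distrib mult.commute)
    qed
  qed
qed auto

text \<open>\<open>ln (nbar j)\<close> is j (ln j)^2, which reduces the claim to Bertrand's series;
  the factor 2 absorbs both the rounding and the shifted logarithm.\<close>

lemma summable_inverse_ln_nbar_floor: "summable (\<lambda>j. 1 / ln (real (nbar_floor j)))"
proof (rule summable_comparison_test_ev)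
  show "summable (\<lambda>j. 2 * (1 / (real j * (ln (real j + 1))\<^sup>2)))"
    by (intro summable_mult summable_bertrand)
  have "\<forall>\<^sub>F j in sequentially. 1 / ln (real (nat \<lfloor>exp (real j * (ln (real j))\<^sup>2)\<rfloor>)) \<le> 2 / (real j * (ln (real j + 1))\<^sup>2)"
    by real_asymp
  moreover have "\<forall>\<^sub>F j in sequentially. 2 \<le> nbar_floor j"
    using nbar_floor_at_top unfolding filterlim_at_top by blast
  ultimately show "\<forall>\<^sub>F j in sequentially. norm (1 / ln (real (nbar_floor j))) \<le> 2 * (1 / (real j * (ln (real j + 1))\<^sup>2))"
    using eventually_nbar_eq by eventually_elim (simp add: nbar_floor_def)
qed

section \<open>Asymptotics of the truncated mean and of the normalisation\<close>

lemma sum_inverse_consecutive_le: "(\<Sum>k=1..n. 1 / (real k * (real k + 1))) \<le> (1::real)"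
proof -
  have "(\<Sum>k=1..n. 1 / (real k * (real k + 1))) = 1 - 1 / (real n + 1)"
  proof (induction n)
    case (Suc n)
    have "1 - 1 / (real n + 1) + 1 / ((real n + 1) * (real n + 2)) = 1 - 1 / (real n + 2)"
      by (simp add: divide_simps) (simp add: algebra_simps)
    with Suc show ?case by (simp add: add_ac)
  qed simp
  then show ?thesis by simp
qed

lemma trunc_mean_approx:
  "\<bar>ln 2 * trunc_mean N - (\<Sum>p\<in>primes_upto N. 1 / real p)\<bar> \<le> 2"
proof -
  have eq: "ln 2 * trunc_mean N = (\<Sum>p\<in>primes_upto N. ln 2 * (real p * digit_prob p))"
    by (simp add: trunc_mean_def sum_distrib_left)
  have up: "ln 2 * (real p * digit_prob p) \<le> 1 / real p" if "p \<in> primes_upto N" for p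
  proof -
    have p: "0 < p" using that by (rule primes_upto_pos)
    have "ln 2 * (real p * digit_prob p) \<le> ln 2 * (real p * (1 / (ln 2 * (real p)\<^sup>2)))"
      by (intro mult_left_mono digit_prob_bounds p) auto
    then show ?thesis using p by (simp add: power2_eq_square)
  qed
  \<comment> \<open>1 / p - p / (p + 1)^2 = (2 p + 1) / (p (p + 1)^2), and 2 p + 1 \<le> 2 (p + 1).
    Summed over all p the loss telescopes to at most 2.\<close>
  have lo: "1 / real p - 2 * (1 / (real p * (real p + 1))) \<le> ln 2 * (real p * digit_prob p)"
    if "p \<in> primes_upto N" for p
  proof -
    have p: "0 < p" using that by (rule primes_upto_pos)
    have "1 / real p - 2 * (1 / (real p * (real p + 1))) \<le> real p / (real p + 1)\<^sup>2"
      using p by (simp add: divide_simps) (simp add: power2_eq_square algebra_simps)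
    also have "\<dots> = ln 2 * (real p * (1 / (ln 2 * (real p + 1)\<^sup>2)))" by simp
    also have "\<dots> \<le> ln 2 * (real p * digit_prob p)"
      by (intro mult_left_mono digit_prob_bounds p) auto
    finally show ?thesis .
  qed
  have "ln 2 * trunc_mean N \<le> (\<Sum>p\<in>primes_upto N. 1 / real p)"
    unfolding eq by (intro sum_mono up)
  moreover have "(\<Sum>p\<in>primes_upto N. 1 / real p) - 2 * (\<Sum>p\<in>primes_upto N. 1 / (real p * (real p + 1)))
      \<le> ln 2 * trunc_mean N"
    unfolding eq sum_distrib_left sum_subtractf[symmetric] by (intro sum_mono lo)
  moreover have "(\<Sum>p\<in>primes_upto N. 1 / (real p * (real p + 1))) \<le> (\<Sum>k=1..N. 1 / (real k * (real k + 1)))"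
    by (intro sum_mono2) (auto dest: primes_uptoD)
  ultimately show ?thesis using sum_inverse_consecutive_le[of N] by linarith
qed

lemma trunc_mean_asymp: "(\<lambda>N. ln 2 * trunc_mean N / ln (ln (real N))) \<longlonglongrightarrow> 1"
proof -
  obtain C where C: "\<And>n. 2 \<le> n \<Longrightarrow> \<bar>(\<Sum>p\<in>primes_upto n. 1 / real p) - ln (ln (real n))\<bar> \<le> C"
    using mertens_second by blast
  have "\<forall>\<^sub>F N::nat in sequentially. 0 < ln (ln (real N))" by real_asymp
  then have "\<forall>\<^sub>F N in sequentially. norm (ln 2 * trunc_mean N / ln (ln (real N)) - 1) \<le> (C + 2) / ln (ln (real N))"
    using eventually_ge_at_top[of 2]
  proof eventually_elim
    case (elim N)
    have "\<bar>ln 2 * trunc_mean N - ln (ln (real N))\<bar> \<le> C + 2"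
      using C[OF elim(2)] trunc_mean_approx[of N] by linarith
    then have "\<bar>ln 2 * trunc_mean N - ln (ln (real N))\<bar> / ln (ln (real N)) \<le> (C + 2) / ln (ln (real N))"
      using elim by (intro divide_right_mono) auto
    moreover have "ln 2 * trunc_mean N / ln (ln (real N)) - 1 = (ln 2 * trunc_mean N - ln (ln (real N))) / ln (ln (real N))"
      using elim by (simp add: diff_divide_distrib)
    ultimately show ?case using elim by simp
  qed
  moreover have "(\<lambda>N. (C + 2) / ln (ln (real N))) \<longlonglongrightarrow> 0" by real_asymp
  ultimately have "(\<lambda>N. ln 2 * trunc_mean N / ln (ln (real N)) - 1) \<longlonglongrightarrow> 0"
    by (rule Lim_null_comparison)
  then show ?thesis by (simp add: LIM_zero_iff)
qed

definition block_norm :: "nat \<Rightarrow> real" where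
  "block_norm j = nbar j * ln (ln (nbar j)) / ln 2"

text \<open>The quotient is a product of three factors tending to 1: the rounding of
  \<open>nbar j\<close>, the effect of this rounding on ln ln, and the asymptotics of the truncated
  mean along \<open>nbar_floor\<close>.\<close>

lemma block_norm_asymp: "(\<lambda>j. real (nbar_floor j) * trunc_mean (nbar_floor j) / block_norm j) \<longlonglongrightarrow> 1"
proof -
  have "((\<lambda>t::real. real (nat \<lfloor>t\<rfloor>) / t) \<longlongrightarrow> 1) at_top" by real_asymp
  from filterlim_compose[OF this nbar_at_top]
  have 1: "(\<lambda>j. real (nbar_floor j) / nbar j) \<longlonglongrightarrow> 1" by (simp add: nbar_floor_def)
  have "((\<lambda>t::real. ln (ln (real (nat \<lfloor>t\<rfloor>))) / ln (ln t)) \<longlongrightarrow> 1) at_top" by real_asymp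
  from filterlim_compose[OF this nbar_at_top]
  have 2: "(\<lambda>j. ln (ln (real (nbar_floor j))) / ln (ln (nbar j))) \<longlonglongrightarrow> 1" by (simp add: nbar_floor_def)
  have 3: "(\<lambda>j. ln 2 * trunc_mean (nbar_floor j) / ln (ln (real (nbar_floor j)))) \<longlonglongrightarrow> 1"
    by (rule filterlim_compose[OF trunc_mean_asymp nbar_floor_at_top])
  have "\<forall>\<^sub>F N::nat in sequentially. 0 < ln (ln (real N))" by real_asymp
  then have "\<forall>\<^sub>F j in sequentially. 0 < ln (ln (real (nbar_floor j)))"
    using nbar_floor_at_top by (rule eventually_compose_filterlim)
  then have "\<forall>\<^sub>F j in sequentially. real (nbar_floor j) / nbar j * (ln (ln (real (nbar_floor j))) / ln (ln (nbar j)))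
      * (ln 2 * trunc_mean (nbar_floor j) / ln (ln (real (nbar_floor j))))
     = real (nbar_floor j) * trunc_mean (nbar_floor j) / block_norm j"
    by eventually_elim (simp add: block_norm_def mult_ac)
  then show ?thesis
    using tendsto_mult[OF tendsto_mult[OF 1 2] 3] by (simp add: tendsto_cong)
qed

lemma AE_prime_digit_sum_trunc_mean:
  "AE x in gauss_measure. (\<lambda>j. (\<Sum>k=1..nbar_floor j. real (prime_digit k x))
     / (real (nbar_floor j) * trunc_mean (nbar_floor j))) \<longlonglongrightarrow> 1"
proof -
  have ge2: "\<forall>\<^sub>F j in sequentially. 2 \<le> nbar_floor j"
    using nbar_floor_at_top unfolding filterlim_at_top by blast
  have "AE x in gauss_measure. \<forall>\<^sub>F j in sequentially. x \<in> space gauss_measure - bad_set (1 / real (Suc i)) (nbar_floor j)" for i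
  proof (rule borel_cantelli_AE1)
    obtain K where K: "\<And>N. 2 \<le> N \<Longrightarrow> measure gauss_measure (bad_set (1 / real (Suc i)) N) \<le> K / ln (real N)"
      using measure_bad_set[of "1 / real (Suc i)"] by auto
    show "summable (\<lambda>j. measure gauss_measure (bad_set (1 / real (Suc i)) (nbar_floor j)))"
    proof (rule summable_comparison_test_ev)
      show "summable (\<lambda>j. K * (1 / ln (real (nbar_floor j))))"
        by (intro summable_mult summable_inverse_ln_nbar_floor)
      show "\<forall>\<^sub>F j in sequentially. norm (measure gauss_measure (bad_set (1 / real (Suc i)) (nbar_floor j)))
          \<le> K * (1 / ln (real (nbar_floor j)))"
        using ge2 by eventually_elim (use K in \<open>simp del: of_nat_Suc\<close>)
    qed
  qed (auto simp: gauss.emeasure_eq_measure)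
  \<comment> \<open>Borel--Cantelli has been applied for each tolerance separately; restricting to
    the tolerances 1 / (i + 1) leaves countably many null sets to discard.\<close>
  then have "AE x in gauss_measure. \<forall>i. \<forall>\<^sub>F j in sequentially. x \<in> space gauss_measure - bad_set (1 / real (Suc i)) (nbar_floor j)"
    unfolding AE_all_countable by blast
  then show ?thesis
  proof eventually_elim
    case (elim x)
    show ?case
    proof (rule tendstoI)
      fix e :: real assume "0 < e"
      then obtain i where i: "1 / real (Suc i) < e"
        using reals_Archimedean[of e] by (auto simp: inverse_eq_divide)
      from elim have "\<forall>\<^sub>F j in sequentially. x \<in> space gauss_measure - bad_set (1 / real (Suc i)) (nbar_floor j)" ..
      then show "\<forall>\<^sub>F j in sequentially. dist ((\<Sum>k=1..nbar_floor j. real (prime_digit k x))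
          / (real (nbar_floor j) * trunc_mean (nbar_floor j))) 1 < e"
        using ge2
      proof eventually_elim
        case (elim j)
        define a where "a = real (nbar_floor j) * trunc_mean (nbar_floor j)"
        define s where "s = (\<Sum>k=1..nbar_floor j. real (prime_digit k x))"
        have a: "0 < a" using trunc_mean_pos[OF elim(2)] elim(2) by (simp add: a_def)
        have "\<bar>s - a\<bar> < 1 / real (Suc i) * a"
          using not_bad_setD[of x "1 / real (Suc i)" "nbar_floor j"] elim(1) by (simp add: a_def s_def)
        also have "\<dots> < e * a" using i a by (rule mult_strict_right_mono)
        finally have "\<bar>s - a\<bar> / a < e" using a by (simp add: divide_less_eq)
        moreover have "s / a - 1 = (s - a) / a" using a by (simp add: diff_divide_distrib)
        ultimately show ?case unfolding dist_real_def a_def[symmetric] s_def[symmetric] using a by simp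
      qed
    qed
  qed
qed

lemma AE_prime_digit_sum_block_norm:
  "AE x in gauss_measure. (\<lambda>j. (\<Sum>k=1..nbar_floor j. real (prime_digit k x)) / block_norm j) \<longlonglongrightarrow> 1"
  using AE_prime_digit_sum_trunc_mean
proof eventually_elim
  case (elim x)
  have "\<forall>\<^sub>F j in sequentially. 2 \<le> nbar_floor j"
    using nbar_floor_at_top unfolding filterlim_at_top by blast
  then have "\<forall>\<^sub>F j in sequentially. (\<Sum>k=1..nbar_floor j. real (prime_digit k x))
      / (real (nbar_floor j) * trunc_mean (nbar_floor j))
      * (real (nbar_floor j) * trunc_mean (nbar_floor j) / block_norm j)
    = (\<Sum>k=1..nbar_floor j. real (prime_digit k x)) / block_norm j"
  proof eventually_elim
    case (elim j)
    have "real (nbar_floor j) * trunc_mean (nbar_floor j) \<noteq> 0"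
      using trunc_mean_pos[OF elim] elim by simp
    then show ?case by simp
  qed
  from Lim_transform_eventually[OF tendsto_mult[OF elim block_norm_asymp] this] show ?case by simp
qed

section \<open>From the ends of the blocks to the limsup\<close>

lemma dprime_eq: "dprime n = block_norm (block_index n)"
  by (simp add: dprime_def block_norm_def)

lemma le_nbar_block_index: "real n \<le> nbar (block_index n)"
proof -
  have "\<forall>\<^sub>F j in sequentially. real n \<le> nbar j"
    using nbar_at_top unfolding filterlim_at_top by blast
  then obtain j where "real n \<le> nbar j" using eventually_happens by force
  then show ?thesis unfolding block_index_def by (rule LeastI)
qed

lemma block_index_at_top: "filterlim block_index at_top sequentially"
  unfolding filterlim_at_top
proof
  fix J
  show "\<forall>\<^sub>F n in sequentially. J \<le> block_index n"
    using eventually_gt_at_top[of "nat \<lceil>nbar J\<rceil>"]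
  proof eventually_elim
    case (elim n)
    then have "nbar J < real n" by linarith
    with le_nbar_block_index[of n] have "nbar J < nbar (block_index n)" by linarith
    then show ?case using nbar_mono[of "block_index n" J] by linarith
  qed
qed

text \<open>A gap of at least 1 between \<open>nbar j\<close> and \<open>nbar (Suc j)\<close> keeps
  the rounded value of the latter strictly above \<open>nbar j\<close>, hence inside its own block.
  These last integers of the blocks form the subsequence for the lower bound.\<close>

lemma eventually_nbar_floor:
  "\<forall>\<^sub>F j in sequentially. nbar_floor j < nbar_floor (Suc j) \<and> block_index (nbar_floor (Suc j)) = Suc j"
proof -
  have "\<forall>\<^sub>F j in sequentially. exp (real j * (ln (real j))\<^sup>2) + 1 \<le> exp (real (Suc j) * (ln (real (Suc j)))\<^sup>2)"
    by real_asymp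
  then show ?thesis
    using eventually_nbar_eq
  proof eventually_elim
    case (elim j)
    then have gap: "nbar j + 1 \<le> nbar (Suc j)" and "0 < nbar j" by (auto simp: nbar_def)
    then have le: "real (nbar_floor (Suc j)) \<le> nbar (Suc j)" and lt: "nbar j < real (nbar_floor (Suc j))"
      and "real (nbar_floor j) \<le> nbar j"
      unfolding nbar_floor_def by linarith+
    have "block_index (nbar_floor (Suc j)) = Suc j"
      unfolding block_index_def
    proof (rule Least_equality)
      fix i assume "real (nbar_floor (Suc j)) \<le> nbar i"
      with lt have "nbar j < nbar i" by linarith
      then show "Suc j \<le> i" using nbar_mono[of i j] by linarith
    qed (rule le)
    with lt \<open>real (nbar_floor j) \<le> nbar j\<close> show ?case by linarith
  qed
qed

text \<open>For the upper bound every n is compared with the last integer of its own block, where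
  monotonicity of \<open>s\<close> applies. For the lower bound the limsup is restricted to the
  subsequence of these last integers.\<close>

lemma limsup_blocks:
  fixes s :: "nat \<Rightarrow> real"
  assumes mono: "mono s" and lim: "(\<lambda>j. s (nbar_floor j) / block_norm j) \<longlonglongrightarrow> 1"
  shows "limsup (\<lambda>n. ereal (s n / dprime n)) = 1"
proof (rule antisym)
  \<comment> \<open>Dividing the inequality for \<open>s\<close> requires a positive normalisation.
    For the first blocks ln ln is negative or a default value, so this holds only
    eventually.\<close>
  have "filterlim (\<lambda>t::real. t * ln (ln t) / ln 2) at_top at_top" by real_asymp
  from filterlim_compose[OF this nbar_at_top]
  have "\<forall>\<^sub>F j in sequentially. 0 < block_norm j"
    unfolding block_norm_def filterlim_at_top_dense by blast
  then have "\<forall>\<^sub>F n in sequentially. 0 < block_norm (block_index n)"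
    using block_index_at_top by (rule eventually_compose_filterlim)
  then have "\<forall>\<^sub>F n in sequentially. ereal (s n / dprime n)
      \<le> ereal (s (nbar_floor (block_index n)) / block_norm (block_index n))"
  proof eventually_elim
    case (elim n)
    have "n \<le> nbar_floor (block_index n)"
      using le_nbar_block_index[of n] by (simp add: nbar_floor_def le_nat_floor)
    then have "s n \<le> s (nbar_floor (block_index n))" by (rule monoD[OF mono])
    then show ?case using elim by (simp add: dprime_eq divide_right_mono)
  qed
  then have "limsup (\<lambda>n. ereal (s n / dprime n))
      \<le> limsup (\<lambda>n. ereal (s (nbar_floor (block_index n)) / block_norm (block_index n)))"
    by (rule Limsup_mono)
  also have "\<dots> = 1"
  proof (rule lim_imp_Limsup)
    show "(\<lambda>n. ereal (s (nbar_floor (block_index n)) / block_norm (block_index n))) \<longlonglongrightarrow> 1"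
      unfolding one_ereal_def by (intro tendsto_ereal filterlim_compose[OF lim block_index_at_top])
  qed simp
  finally show "limsup (\<lambda>n. ereal (s n / dprime n)) \<le> 1" .
next
  obtain J where J: "\<And>j. J \<le> j \<Longrightarrow> nbar_floor j < nbar_floor (Suc j) \<and> block_index (nbar_floor (Suc j)) = Suc j"
    using eventually_nbar_floor unfolding eventually_sequentially by blast
  \<comment> \<open>The shift is \<open>Suc J\<close> because the block index is known at
    successors: \<open>J\<close> applied to i + J yields block i + \<open>Suc J\<close>.\<close>
  define r where "r i = nbar_floor (i + Suc J)" for i
  have "strict_mono r"
    unfolding strict_mono_Suc_iff r_def using J by simp
  then have "limsup ((\<lambda>n. ereal (s n / dprime n)) \<circ> r) \<le> limsup (\<lambda>n. ereal (s n / dprime n))"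
    by (rule limsup_subseq_mono)
  moreover have "limsup ((\<lambda>n. ereal (s n / dprime n)) \<circ> r) = 1"
  proof (rule lim_imp_Limsup)
    have "dprime (r i) = block_norm (i + Suc J)" for i
      using J[of "i + J"] by (simp add: r_def dprime_eq)
    then have "(\<lambda>n. ereal (s n / dprime n)) \<circ> r = (\<lambda>i. ereal (s (nbar_floor (i + Suc J)) / block_norm (i + Suc J)))"
      by (auto simp: r_def)
    then show "((\<lambda>n. ereal (s n / dprime n)) \<circ> r) \<longlonglongrightarrow> 1"
      unfolding one_ereal_def
      using tendsto_ereal[OF LIMSEQ_ignore_initial_segment[OF lim, of "Suc J"]] by simp
  qed simp
  ultimately show "1 \<le> limsup (\<lambda>n. ereal (s n / dprime n))" by simp
qed

theorem theorem2p6: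
  shows "AE x in lborel. x \<in> {0<..1} \<longrightarrow>
    limsup (\<lambda>n. ereal ((\<Sum>k=1..n. real (prime_digit k x)) / dprime n)) = 1"
proof -
  have mono: "mono (\<lambda>n. \<Sum>k=1..n. real (prime_digit k x))" for x
    by (intro monoI sum_mono2) auto
  have "AE x in gauss_measure. limsup (\<lambda>n. ereal ((\<Sum>k=1..n. real (prime_digit k x)) / dprime n)) = 1"
    using AE_prime_digit_sum_block_norm by eventually_elim (rule limsup_blocks[OF mono])
  then show ?thesis unfolding AE_gauss_iff by eventually_elim auto
qed

end
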